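(* Let $l\in\mathbb{N}$ with $l>1$. Let $(t_1,x_1),(t_2,x_2)\in\mathbb{R}\times\mathbb{T}$, $v_1,v_2\in\mathbb{R}$, $v_1\ne v_2$, and $T>0$. Then the quantitative observability $$\int_{\mathbb{T}}|u_0|^2\,dx\lesssim\int_0^T\bigl(|u(t_1+t,x_1-v_1t)|^2+|u(t_2+t,x_2-v_2t)|^2\bigr)\,dt$$ holds for all solutions $u$ of $$\partial_tu=i\bigl(-\partial_x^2u+\partial_x^4u+\cdots+(-1)^l\partial_x^{2l}u\bigr),\qquad u(0,x)=u_0(x)\in L^2(\mathbb{T}).$$
   Context: $\mathbb{T}=\mathbb{R}/2\pi\mathbb{Z}$, $\mathbb{N}=\{1,2,3,\dots\}$. For $u_0=\sum_{k\in\mathbb{Z}}c_ke^{ikx}\in L^2(\mathbb{T})$ the solution of the equation is $u(t,x)=\sum_{k\in\mathbb{Z}}c_ke^{ip(k)t}e^{ikx}$ with $p(k)=k^2+k^4+\cdots+k^{2l}$, and its restriction to a line is given by the series $u(t_0+t,x_0-vt)=\sum_{k\in\mathbb{Z}}c_ke^{i(p(k)t_0+kx_0)}e^{i(p(k)-kv)t}$. $A\lesssim B$ means $A\le CB$ with a constant $C>0$ independent of the solution $u$ (it may depend on $l,v_i,T$ and other data). *)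

theory Defs
  imports "HOL-Analysis.Analysis"
begin

definition square_integrable_on :: "(real \<Rightarrow> complex) \<Rightarrow> real set \<Rightarrow> bool"
    (infix "square'_integrable'_on" 50) where
  "f square_integrable_on S \<longleftrightarrow>
     f \<in> borel_measurable (lebesgue_on S) \<and>
     integrable (lebesgue_on S) (\<lambda>x. (cmod (f x))\<^sup>2)"

text \<open>
  Unconditional convergence of a series indexed by the integers to \<open>g\<close> in the L2 norm on \<open>S\<close>.
  The terms are required to be square integrable because the Bochner integral of a
  non-integrable function is 0 by convention.
\<close>

definition has_L2_sum :: "(int \<Rightarrow> real \<Rightarrow> complex) \<Rightarrow> (real \<Rightarrow> complex) \<Rightarrow> real set \<Rightarrow> bool" where
  "has_L2_sum f g S \<longleftrightarrow>
     (\<forall>k. f k square_integrable_on S) \<and> g square_integrable_on S \<and>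
     ((\<lambda>K. \<integral>s. (cmod ((\<Sum>k\<in>K. f k s) - g s))\<^sup>2 \<partial>lebesgue_on S) \<longlongrightarrow> 0)
       (finite_subsets_at_top UNIV)"

text \<open>
  Functions on \<open>\<real> / 2\<pi>\<int>\<close> are \<open>2\<pi>\<close>-periodic functions on the line, and points of the torus are
  given by real representatives. Elements of L2 are represented by functions.
\<close>

definition L2_torus :: "(real \<Rightarrow> complex) set" where
  "L2_torus = {f. (\<forall>x. f (x + 2 * pi) = f x) \<and> f square_integrable_on {0..2 * pi}}"

definition torus_inner :: "(real \<Rightarrow> complex) \<Rightarrow> (real \<Rightarrow> complex) \<Rightarrow> complex" where
  "torus_inner f g = (\<integral>x. f x * cnj (g x) \<partial>lebesgue_on {0..2 * pi})"

definition fourier_mode :: "int \<Rightarrow> real \<Rightarrow> complex" where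
  "fourier_mode k x = exp (\<i> * of_int k * of_real x)"

definition fourier_coeff :: "(real \<Rightarrow> complex) \<Rightarrow> int \<Rightarrow> complex" where
  "fourier_coeff f k = torus_inner f (fourier_mode k) / (2 * pi)"

definition spatial_deriv :: "(real \<Rightarrow> complex) \<Rightarrow> real \<Rightarrow> complex" where
  "spatial_deriv f x = vector_derivative f (at x)"

definition spatial_op :: "nat \<Rightarrow> (real \<Rightarrow> complex) \<Rightarrow> real \<Rightarrow> complex" where
  "spatial_op l f x = (\<Sum>j=1..l. (-1) ^ j * (spatial_deriv ^^ (2 * j)) f x)"

text \<open>
  \<open>u t\<close> is the state at time \<open>t\<close>. For data in L2 the equation \<open>\<partial>\<^sub>t u = \<i> P u\<close>, with
  \<open>P = spatial_op l\<close>, holds in the sense of distributions on the torus: it is tested against the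
  exponentials, whose span is dense in the smooth functions. As \<open>P\<close> is symmetric (even order
  derivatives with real coefficients), it is moved to the test function without a change of sign.
  The theorem \<open>is_solution_iff\<close> below shows that this means
  \<open>u t x = (\<Sum>k. c\<^sub>k * exp (\<i> * p k * t) * exp (\<i> * k * x))\<close>, where \<open>c\<^sub>k\<close> are the Fourier
  coefficients of the initial datum.
\<close>

definition is_solution :: "nat \<Rightarrow> (real \<Rightarrow> complex) \<Rightarrow> (real \<Rightarrow> real \<Rightarrow> complex) \<Rightarrow> bool" where
  "is_solution l u0 u \<longleftrightarrow>
     (\<forall>t. u t \<in> L2_torus) \<and>
     (AE x in lebesgue_on {0..2 * pi}. u 0 x = u0 x) \<and>
     (\<forall>k t. ((\<lambda>s. torus_inner (u s) (fourier_mode k)) has_vector_derivative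
              \<i> * torus_inner (u t) (spatial_op l (fourier_mode k))) (at t))"

text \<open>
  The restriction of \<open>u\<close> to the line \<open>t \<mapsto> (t0 + t, x0 - v * t)\<close>, \<open>0 \<le> t \<le> T\<close>. A line is a null
  set, so the pointwise values of \<open>u\<close> are meaningless there; the restriction is the sum in
  L2 on \<open>[0, T]\<close> of the Fourier series of \<open>u\<close> evaluated along the line. By \<open>line_term_eq\<close> its terms
  are \<open>c\<^sub>k * exp (\<i> * (p k * t0 + k * x0)) * exp (\<i> * (p k - k * v) * t)\<close>. The sum is unique up to
  null sets (\<open>has_L2_sum_unique\<close>), so integrals of the restriction do not depend on the choice.
\<close>

definition line_term :: "(real \<Rightarrow> real \<Rightarrow> complex) \<Rightarrow> real \<Rightarrow> real \<Rightarrow> real \<Rightarrow> int \<Rightarrow> real \<Rightarrow> complex" where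
  "line_term u t0 x0 v k t = fourier_coeff (u (t0 + t)) k * fourier_mode k (x0 - v * t)"

definition line_restriction ::
    "(real \<Rightarrow> real \<Rightarrow> complex) \<Rightarrow> real \<Rightarrow> real \<Rightarrow> real \<Rightarrow> real \<Rightarrow> real \<Rightarrow> complex" where
  "line_restriction u t0 x0 v T = (SOME g. has_L2_sum (line_term u t0 x0 v) g {0..T})"

definition dispersion :: "nat \<Rightarrow> int \<Rightarrow> real" where
  "dispersion l k = (\<Sum>j=1..l. of_int k ^ (2 * j))"

lemma spatial_deriv_power_mode:
  "(spatial_deriv ^^ n) (fourier_mode k) = (\<lambda>x. (\<i> * of_int k) ^ n * fourier_mode k x)"
proof (induction n)
  case (Suc n)
  have "((\<lambda>x. (\<i> * of_int k) ^ n * fourier_mode k x) has_vector_derivative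
          (\<i> * of_int k) ^ Suc n * fourier_mode k x) (at x)" for x
    unfolding fourier_mode_def
    by (rule has_vector_derivative_real_field derivative_eq_intros refl | simp)+
  then have "spatial_deriv (\<lambda>x. (\<i> * of_int k) ^ n * fourier_mode k x) =
      (\<lambda>x. (\<i> * of_int k) ^ Suc n * fourier_mode k x)"
    unfolding spatial_deriv_def by (intro ext vector_derivative_at)
  with Suc show ?case
    by simp
qed auto

lemma spatial_op_mode:
  "spatial_op l (fourier_mode k) = (\<lambda>x. of_real (dispersion l k) * fourier_mode k x)"
proof -
  have *: "(-1) ^ j * ((\<i> * of_int k) ^ (2 * j) * z) = of_int k ^ (2 * j) * z" for j and z :: complex
  proof -
    have "(\<i> * of_int k) ^ (2 * j) = (-1) ^ j * (of_int k :: complex) ^ (2 * j)"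
      by (simp add: power_mult power_mult_distrib power_minus [of "(of_int k)\<^sup>2"])
    then show ?thesis
      by (simp add: mult.assoc [symmetric] power_mult_distrib [symmetric])
  qed
  show ?thesis
    unfolding spatial_op_def spatial_deriv_power_mode * dispersion_def
    by (simp add: sum_distrib_right)
qed

lemma torus_inner_spatial_op:
  "torus_inner f (spatial_op l (fourier_mode k)) =
     of_real (dispersion l k) * torus_inner f (fourier_mode k)"
proof -
  have "f x * cnj (of_real (dispersion l k) * fourier_mode k x) =
      of_real (dispersion l k) * (f x * cnj (fourier_mode k x))" for x
    by simp
  then show ?thesis
    by (simp only: torus_inner_def spatial_op_mode integral_mult_right_zero)
qed

lemma torus_inner_cong_AE:
  assumes "f \<in> L2_torus" "g \<in> L2_torus" "AE x in lebesgue_on {0..2 * pi}. f x = g x"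
  shows "torus_inner f (fourier_mode k) = torus_inner g (fourier_mode k)"
proof -
  have m: "(\<lambda>x. cnj (fourier_mode k x)) \<in> borel_measurable (lebesgue_on {0..2 * pi})"
    by (intro continuous_imp_measurable_on_sets_lebesgue)
       (auto simp: fourier_mode_def intro!: continuous_intros)
  show ?thesis
    unfolding torus_inner_def
    using assms m
    by (intro integral_cong_AE borel_measurable_times)
       (auto simp: L2_torus_def square_integrable_on_def)
qed

theorem is_solution_iff:
  assumes "u0 \<in> L2_torus"
  shows "is_solution l u0 u \<longleftrightarrow>
     (\<forall>t. u t \<in> L2_torus) \<and>
     (AE x in lebesgue_on {0..2 * pi}. u 0 x = u0 x) \<and>
     (\<forall>k t. fourier_coeff (u t) k =
              fourier_coeff u0 k * exp (\<i> * of_real (dispersion l k) * of_real t))"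
    (is "?L \<longleftrightarrow> ?A \<and> ?B \<and> ?C")
proof -
  have "?L \<longleftrightarrow> ?C" if A: ?A and B: ?B
  proof
    assume L: ?L
    show ?C
    proof (intro allI)
      fix k t
      define c where "c = \<i> * of_real (dispersion l k)"
      define y where "y = (\<lambda>s. torus_inner (u s) (fourier_mode k))"
      have y: "(y has_vector_derivative c * y s) (at s)" for s
        using L by (simp add: is_solution_def torus_inner_spatial_op c_def y_def mult.assoc)
      have e: "((\<lambda>s. exp (- c * of_real s)) has_vector_derivative - c * exp (- c * of_real s)) (at s)"
        for s :: real
        by (rule has_vector_derivative_real_field derivative_eq_intros refl | simp)+
      have "((\<lambda>s. y s * exp (- c * of_real s)) has_vector_derivative 0) (at s)" for s
        using has_vector_derivative_mult [OF y e, of s] by (simp add: algebra_simps)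
      then obtain a where a: "\<And>s. y s * exp (- c * of_real s) = a"
        using has_vector_derivative_zero_constant [of UNIV "\<lambda>s. y s * exp (- c * of_real s)"]
        by auto
      have "y t * exp (- c * of_real t) = y 0"
        using a [of t] a [of 0] by simp
      then have "y t = y 0 * exp (c * of_real t)"
        by (simp add: exp_minus field_simps)
      moreover have "y 0 = torus_inner u0 (fourier_mode k)"
        unfolding y_def using A B assms by (intro torus_inner_cong_AE) auto
      ultimately show "fourier_coeff (u t) k =
          fourier_coeff u0 k * exp (\<i> * of_real (dispersion l k) * of_real t)"
        by (simp add: fourier_coeff_def y_def c_def)
    qed
  next
    assume C: ?C
    have "((\<lambda>s. torus_inner (u s) (fourier_mode k)) has_vector_derivative
              \<i> * torus_inner (u t) (spatial_op l (fourier_mode k))) (at t)" for k t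
    proof -
      have *: "torus_inner (u s) (fourier_mode k) = torus_inner u0 (fourier_mode k) *
                 exp (\<i> * of_real (dispersion l k) * of_real s)" for s
        using C by (simp add: fourier_coeff_def)
      show ?thesis
        unfolding torus_inner_spatial_op *
        by (rule has_vector_derivative_real_field derivative_eq_intros refl | simp)+
    qed
    with A B show ?L
      by (simp add: is_solution_def)
  qed
  moreover have "?L \<Longrightarrow> ?A \<and> ?B"
    by (simp add: is_solution_def)
  ultimately show ?thesis
    by blast
qed

lemma line_term_eq:
  assumes "u0 \<in> L2_torus" "is_solution l u0 u"
  shows "line_term u t0 x0 v k t =
     fourier_coeff u0 k * exp (\<i> * of_real (dispersion l k * t0 + of_int k * x0)) *
       exp (\<i> * of_real (dispersion l k - of_int k * v) * of_real t)"
  using assms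
  by (simp add: line_term_def is_solution_iff fourier_mode_def mult.assoc flip: exp_add)
     (simp add: algebra_simps)

lemma square_integrable_diff:
  assumes "f square_integrable_on S" "g square_integrable_on S"
  shows "(\<lambda>x. f x - g x) square_integrable_on S"
proof -
  have *: "(cmod (a - b))\<^sup>2 \<le> 2 * (cmod a)\<^sup>2 + 2 * (cmod b)\<^sup>2" for a b
  proof -
    have "(cmod (a - b))\<^sup>2 \<le> (cmod a + cmod b)\<^sup>2"
      by (intro power_mono norm_triangle_ineq4) auto
    also have "\<dots> \<le> 2 * (cmod a)\<^sup>2 + 2 * (cmod b)\<^sup>2"
      using sum_squares_bound [of "cmod a" "cmod b"] by (simp add: power2_sum)
    finally show ?thesis .
  qed
  have m: "(\<lambda>x. f x - g x) \<in> borel_measurable (lebesgue_on S)"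
    using assms by (auto simp: square_integrable_on_def)
  have "integrable (lebesgue_on S) (\<lambda>x. 2 * (cmod (f x))\<^sup>2 + 2 * (cmod (g x))\<^sup>2)"
    using assms by (auto simp: square_integrable_on_def)
  then have "integrable (lebesgue_on S) (\<lambda>x. (cmod (f x - g x))\<^sup>2)"
    by (rule Bochner_Integration.integrable_bound) (use m * in auto)
  with m show ?thesis
    by (simp add: square_integrable_on_def)
qed

lemma square_integrable_sum:
  assumes "\<And>k. f k square_integrable_on S"
  shows "finite K \<Longrightarrow> (\<lambda>x. \<Sum>k\<in>K. f k x) square_integrable_on S"
proof (induction K rule: finite_induct)
  case (insert k K)
  have "(\<lambda>x. 0 - f k x) square_integrable_on S"
    using assms by (intro square_integrable_diff) (auto simp: square_integrable_on_def)
  from square_integrable_diff [OF insert.IH this] insert.hyps show ?case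
    by (simp add: add.commute)
qed (auto simp: square_integrable_on_def)

lemma has_L2_sum_unique:
  assumes "has_L2_sum f g S" "has_L2_sum f h S"
  shows "AE x in lebesgue_on S. g x = h x"
proof -
  let ?M = "lebesgue_on S"
  let ?I = "\<lambda>q K. \<integral>x. (cmod ((\<Sum>k\<in>K. f k x) - q x))\<^sup>2 \<partial>?M"
  have *: "(cmod (b - c))\<^sup>2 \<le> 2 * (cmod (a - b))\<^sup>2 + 2 * (cmod (a - c))\<^sup>2" for a b c
  proof -
    have "(cmod (b - c))\<^sup>2 \<le> (cmod (a - b) + cmod (a - c))\<^sup>2"
      using norm_triangle_ineq4 [of "a - c" "a - b"] by (intro power_mono) auto
    also have "\<dots> \<le> 2 * (cmod (a - b))\<^sup>2 + 2 * (cmod (a - c))\<^sup>2"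
      using sum_squares_bound [of "cmod (a - b)" "cmod (a - c)"] by (simp add: power2_sum)
    finally show ?thesis .
  qed
  have gh: "g square_integrable_on S" "h square_integrable_on S"
    and f: "\<And>k. f k square_integrable_on S"
    using assms by (auto simp: has_L2_sum_def)
  have d: "integrable ?M (\<lambda>x. (cmod (g x - h x))\<^sup>2)"
    using square_integrable_diff [OF gh] by (simp add: square_integrable_on_def)
  have "(\<integral>x. (cmod (g x - h x))\<^sup>2 \<partial>?M) \<le> 2 * ?I g K + 2 * ?I h K" if "finite K" for K
  proof -
    have i: "integrable ?M (\<lambda>x. (cmod ((\<Sum>k\<in>K. f k x) - q x))\<^sup>2)" if "q \<in> {g, h}" for q
      using square_integrable_diff [OF square_integrable_sum [of f S K]] f gh \<open>finite K\<close> that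
      by (auto simp: square_integrable_on_def)
    have "(\<integral>x. (cmod (g x - h x))\<^sup>2 \<partial>?M) \<le>
        (\<integral>x. 2 * (cmod ((\<Sum>k\<in>K. f k x) - g x))\<^sup>2 + 2 * (cmod ((\<Sum>k\<in>K. f k x) - h x))\<^sup>2 \<partial>?M)"
      using i d * by (intro integral_mono) auto
    also have "\<dots> = 2 * ?I g K + 2 * ?I h K"
      using i by simp
    finally show ?thesis .
  qed
  then have ev: "\<forall>\<^sub>F K in finite_subsets_at_top UNIV.
      (\<integral>x. (cmod (g x - h x))\<^sup>2 \<partial>?M) \<le> 2 * ?I g K + 2 * ?I h K"
    by (auto intro: eventually_finite_subsets_at_top_weakI)
  have "((\<lambda>K. 2 * ?I g K + 2 * ?I h K) \<longlongrightarrow> 2 * 0 + 2 * 0) (finite_subsets_at_top UNIV)"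
    using assms by (intro tendsto_intros) (auto simp: has_L2_sum_def)
  from tendsto_lowerbound [OF this ev] have "(\<integral>x. (cmod (g x - h x))\<^sup>2 \<partial>?M) \<le> 0"
    by simp
  moreover have "(\<integral>x. (cmod (g x - h x))\<^sup>2 \<partial>?M) \<ge> 0"
    by (intro integral_nonneg_AE) auto
  ultimately have "(\<integral>x. (cmod (g x - h x))\<^sup>2 \<partial>?M) = 0"
    by simp
  then have "AE x in ?M. (cmod (g x - h x))\<^sup>2 = 0"
    using integral_nonneg_eq_0_iff_AE [OF d] by simp
  then show ?thesis
    by simp
qed

end

theory Submission
  imports Defs
begin

text \<open>
  Along a line the solution is a nonharmonic Fourier series with frequencies \<open>p(k) - k v\<close>. Since
  \<open>l > 1\<close>, distinct frequencies are so far apart that the sums of their inverse distances have small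
  tails. By Schur's test the exponentials with large \<open>k\<close> are then almost orthogonal on \<open>[0, T]\<close>, and
  the finitely many remaining frequencies are added one at a time (Haraux's trick). This
  gives an Ingham inequality for the distinct frequencies of each line, for every \<open>T > 0\<close>.

  On one line distinct \<open>k\<close> may share a frequency, and then only their sum is observed. As \<open>p\<close> is
  strictly convex, each frequency occurs at most twice, and alternating between the two
  lines gives chains of indices that never close up. For a speed \<open>v \<noteq> 0\<close> only finitely many \<open>k\<close> resonate,
  so every chain ends at a coefficient that is observed alone.

  All estimates are made for finite sums; they carry over to \<open>u\<close> because the partial sums along a line
  converge in L2, and Parseval's identity turns coefficients into \<open>u0\<close>.
\<close>

section \<open>Nonharmonic exponential sums\<close>

text \<open>The hypothesis \<open>l > 1\<close> decides how resonances behave. For a purely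
  quadratic symbol \<open>k\<close> and \<open>m\<close> share a frequency exactly when
  \<open>k + m = v\<close>; with odd integer speeds every index has a distinct partner on both
  lines, and the chain \<open>k\<close>, \<open>v2 - k\<close>, \<open>k + v1 - v2\<close>, ... runs
  on forever with no coefficient seen alone. The quartic term makes \<open>|p(k) - p(m)|\<close> at
  least \<open>|k^2 - m^2| * (1 + k^2 + m^2)\<close>, which the linear term can cancel only for
  small indices or, at speed zero, for \<open>m = -k\<close>. At speed zero all pairs
  \<open>k\<close>, \<open>-k\<close> resonate, so that line alone loses infinitely many
  coefficients. The other speed is then nonzero, and its line observes all but finitely many indices
  one by one with a single constant. Chains serve only the finite remainder, where constants
  depending on the index are harmless. Hence the asymmetric roles of the two lines. The base points
  enter only through phases of modulus one, which is why the finite estimates allow two coefficient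
  families with equal moduli.\<close>

definition exp_sum :: "real set \<Rightarrow> (real \<Rightarrow> complex) \<Rightarrow> real \<Rightarrow> complex" where
  "exp_sum W a t = (\<Sum>w\<in>W. a w * cis (w * t))"

definition energy :: "real \<Rightarrow> real set \<Rightarrow> (real \<Rightarrow> complex) \<Rightarrow> real" where
  "energy T W a = integral {0..T} (\<lambda>t. (cmod (exp_sum W a t))\<^sup>2)"

lemma cmod_add_sq_le: "(cmod (a + b))\<^sup>2 \<le> 2 * (cmod a)\<^sup>2 + 2 * (cmod b)\<^sup>2"
proof -
  have "(cmod (a + b))\<^sup>2 \<le> (cmod a + cmod b)\<^sup>2"
    by (intro power_mono norm_triangle_ineq) auto
  also have "\<dots> \<le> 2 * (cmod a)\<^sup>2 + 2 * (cmod b)\<^sup>2"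
    using sum_squares_bound [of "cmod a" "cmod b"] by (simp add: power2_sum)
  finally show ?thesis .
qed

lemma cmod_diff_sq_le: "(cmod (a - b))\<^sup>2 \<le> 2 * (cmod a)\<^sup>2 + 2 * (cmod b)\<^sup>2"
  using cmod_add_sq_le [of a "- b"] by simp

lemma continuous_on_cis_mult [continuous_intros]:
  "continuous_on S f \<Longrightarrow> continuous_on S (\<lambda>t::real. cis (f t))"
  unfolding cis_conv_exp by (intro continuous_intros)

lemma continuous_on_exp_sum [continuous_intros]:
  "continuous_on S f \<Longrightarrow> continuous_on S (\<lambda>t. exp_sum W a (f t))" for f :: "real \<Rightarrow> real"
  unfolding exp_sum_def by (intro continuous_intros)

lemma integrable_on_exp_sum:
  "(\<lambda>t. (cmod (exp_sum W a t))\<^sup>2) integrable_on {c..d}"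
  by (intro integrable_continuous_interval continuous_intros)

lemma energy_nonneg: "energy T W a \<ge> 0"
  unfolding energy_def by (intro integral_nonneg integrable_on_exp_sum) auto

lemma norm_integral_cis_le:
  assumes "x \<noteq> 0" "T \<ge> 0"
  shows "cmod (integral {0..T} (\<lambda>t. cis (x * t))) \<le> 2 / \<bar>x\<bar>"
proof -
  have "((\<lambda>t. cis (x * t)) has_integral cis (x * T) / (\<i> * x) - cis (x * 0) / (\<i> * x)) {0..T}"
  proof (rule fundamental_theorem_of_calculus [OF assms(2)])
    fix t assume "t \<in> {0..T}"
    show "((\<lambda>t. cis (x * t) / (\<i> * x)) has_vector_derivative cis (x * t)) (at t within {0..T})"
      unfolding cis_conv_exp using assms(1)
      by (auto intro!: has_vector_derivative_real_field derivative_eq_intros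
          simp: field_simps power2_eq_square)
  qed
  then have "integral {0..T} (\<lambda>t. cis (x * t)) = (cis (x * T) - 1) / (\<i> * x)"
    by (simp add: integral_unique diff_divide_distrib)
  moreover have "cmod (cis (x * T) - 1) \<le> 2"
    using norm_triangle_ineq4 [of "cis (x * T)" 1] by simp
  ultimately show ?thesis
    by (simp add: norm_divide norm_mult divide_right_mono)
qed

lemma energy_expand:
  assumes "finite W"
  shows "complex_of_real (energy T W a) =
    (\<Sum>w\<in>W. \<Sum>w'\<in>W. a w * cnj (a w') * integral {0..T} (\<lambda>t. cis ((w - w') * t)))"
proof -
  have sq: "complex_of_real ((cmod (exp_sum W a t))\<^sup>2) =
      (\<Sum>w\<in>W. \<Sum>w'\<in>W. a w * cnj (a w') * cis ((w - w') * t))" for t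
    unfolding complex_norm_square exp_sum_def cnj_sum sum_product
    by (intro sum.cong refl)
       (simp add: cis_cnj left_diff_distrib cis_mult)
  have "((\<lambda>t. \<Sum>w\<in>W. \<Sum>w'\<in>W. a w * cnj (a w') * cis ((w - w') * t)) has_integral
      (\<Sum>w\<in>W. \<Sum>w'\<in>W. a w * cnj (a w') * integral {0..T} (\<lambda>t. cis ((w - w') * t)))) {0..T}"
    by (intro has_integral_sum has_integral_mult_right integrable_integral
          integrable_continuous_interval continuous_intros assms)
  then have "((\<lambda>t. complex_of_real ((cmod (exp_sum W a t))\<^sup>2)) has_integral
      (\<Sum>w\<in>W. \<Sum>w'\<in>W. a w * cnj (a w') * integral {0..T} (\<lambda>t. cis ((w - w') * t)))) {0..T}"
    unfolding sq .
  moreover have "((\<lambda>t. complex_of_real ((cmod (exp_sum W a t))\<^sup>2)) has_integral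
      complex_of_real (energy T W a)) {0..T}"
    unfolding energy_def by (intro has_integral_of_real integrable_integral integrable_on_exp_sum)
  ultimately show ?thesis
    using has_integral_unique by blast
qed

text \<open>The diagonal contributes \<open>1 / 0 = 0\<close> to the sum in the assumption.\<close>

lemma energy_near_diagonal:
  assumes "finite W" "T \<ge> 0" and small: "\<And>w. w \<in> W \<Longrightarrow> (\<Sum>w'\<in>W. 1 / \<bar>w - w'\<bar>) \<le> e"
  shows "\<bar>energy T W a - T * (\<Sum>w\<in>W. (cmod (a w))\<^sup>2)\<bar> \<le> 2 * e * (\<Sum>w\<in>W. (cmod (a w))\<^sup>2)"
proof -
  define I where "I = (\<lambda>w w'. integral {0..T} (\<lambda>t. cis ((w - w') * t)))"
  define A where "A = (\<lambda>w. (cmod (a w))\<^sup>2)"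
  have diag: "(\<Sum>w'\<in>W. if w' = w then a w * cnj (a w') * T else 0) = of_real (T * A w)" if "w \<in> W" for w
    using that assms(1) by (simp add: A_def complex_norm_square [symmetric] mult.commute flip: of_real_power)
  have "complex_of_real (energy T W a - T * (\<Sum>w\<in>W. A w)) =
      (\<Sum>w\<in>W. (\<Sum>w'\<in>W. a w * cnj (a w') * I w w') - of_real (T * A w))"
    using energy_expand [OF assms(1), of T a]
    by (simp add: sum_subtractf I_def sum_distrib_left)
  also have "\<dots> = (\<Sum>w\<in>W. \<Sum>w'\<in>W. a w * cnj (a w') * I w w'
       - (if w' = w then a w * cnj (a w') * T else 0))"
    by (intro sum.cong refl) (simp only: sum_subtractf diag)
  finally have "\<bar>energy T W a - T * (\<Sum>w\<in>W. A w)\<bar> = cmod (\<Sum>w\<in>W. \<Sum>w'\<in>W.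
      a w * cnj (a w') * I w w' - (if w' = w then a w * cnj (a w') * T else 0))"
    by (metis norm_of_real)
  also have "\<dots> \<le> (\<Sum>w\<in>W. \<Sum>w'\<in>W. (A w + A w') * (1 / \<bar>w - w'\<bar>))"
  proof (intro sum_norm_le order_trans [OF sum_norm_le])
    fix w w' assume "w \<in> W" "w' \<in> W"
    show "cmod (a w * cnj (a w') * I w w' - (if w' = w then a w * cnj (a w') * T else 0))
        \<le> (A w + A w') * (1 / \<bar>w - w'\<bar>)"
    proof (cases "w = w'")
      case True
      then show ?thesis using assms(2) by (simp add: I_def cis_zero scaleR_conv_of_real)
    next
      case False
      have "cmod (a w * cnj (a w') * I w w') \<le> cmod (a w) * cmod (a w') * (2 / \<bar>w - w'\<bar>)"
        unfolding norm_mult I_def complex_mod_cnj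
        using norm_integral_cis_le [of "w - w'" T] False assms(2)
        by (intro mult_left_mono) auto
      also have "\<dots> = 2 * cmod (a w) * cmod (a w') * (1 / \<bar>w - w'\<bar>)"
        by simp
      also have "\<dots> \<le> (A w + A w') * (1 / \<bar>w - w'\<bar>)"
        unfolding A_def by (intro mult_right_mono sum_squares_bound) auto
      finally show ?thesis using False by auto
    qed
  qed
  \<comment> \<open>Schur's test: the kernel is symmetric, so both halves reduce to the same row
    sums, each at most \<open>e\<close>.\<close>
  also have "\<dots> = (\<Sum>w\<in>W. \<Sum>w'\<in>W. A w * (1 / \<bar>w - w'\<bar>)) + (\<Sum>w\<in>W. \<Sum>w'\<in>W. A w' * (1 / \<bar>w - w'\<bar>))"
    by (simp add: distrib_right add_divide_distrib sum.distrib)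
  also have "(\<Sum>w\<in>W. \<Sum>w'\<in>W. A w' * (1 / \<bar>w - w'\<bar>)) = (\<Sum>w\<in>W. \<Sum>w'\<in>W. A w * (1 / \<bar>w - w'\<bar>))"
    by (subst sum.swap) (simp add: abs_minus_commute)
  also have "(\<Sum>w\<in>W. \<Sum>w'\<in>W. A w * (1 / \<bar>w - w'\<bar>)) \<le> (\<Sum>w\<in>W. A w * e)"
    unfolding sum_distrib_left [symmetric] A_def
    by (intro sum_mono mult_left_mono small) auto
  finally show ?thesis
    unfolding A_def by (simp add: sum_distrib_left [symmetric] mult.commute [of _ e])
qed

text \<open>All lengths above \<open>T0\<close> are required at once because inserting a frequency
  shifts the sum in time and costs some length; an open range absorbs any finite number of such
  losses. The upper bound is kept because the insertion step subtracts the old part of the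
  sum.\<close>

definition riesz :: "real \<Rightarrow> real set \<Rightarrow> bool" where
  "riesz T0 \<Omega> \<longleftrightarrow> (\<forall>T>T0. \<exists>C>0. \<forall>W a. finite W \<longrightarrow> W \<subseteq> \<Omega> \<longrightarrow>
     (\<Sum>w\<in>W. (cmod (a w))\<^sup>2) \<le> C * energy T W a \<and> energy T W a \<le> C * (\<Sum>w\<in>W. (cmod (a w))\<^sup>2))"

text \<open>Row sums of at most \<open>T0 / 4\<close> make the off-diagonal part at most
  \<open>T0 / 2\<close> times the coefficient sum, less than half of the diagonal factor
  \<open>T\<close>.\<close>

lemma riesz_sparse:
  assumes "T0 > 0"
    and small: "\<And>W w. finite W \<Longrightarrow> W \<subseteq> \<Omega> \<Longrightarrow> w \<in> W \<Longrightarrow> (\<Sum>w'\<in>W. 1 / \<bar>w - w'\<bar>) \<le> T0 / 4"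
  shows "riesz T0 \<Omega>"
  unfolding riesz_def
proof (intro allI impI)
  fix T assume T: "T > T0"
  define C where "C = max (2 / T0) (2 * T)"
  have C: "C > 0" "1 \<le> C * (T0 / 2)" "2 * T \<le> C"
  proof -
    show "C > 0" "2 * T \<le> C" using assms T by (auto simp: C_def)
    have "2 / T0 * (T0 / 2) \<le> C * (T0 / 2)"
      using assms by (intro mult_right_mono) (auto simp: C_def)
    then show "1 \<le> C * (T0 / 2)" using assms by simp
  qed
  show "\<exists>C>0. \<forall>W a. finite W \<longrightarrow> W \<subseteq> \<Omega> \<longrightarrow>
     (\<Sum>w\<in>W. (cmod (a w))\<^sup>2) \<le> C * energy T W a \<and> energy T W a \<le> C * (\<Sum>w\<in>W. (cmod (a w))\<^sup>2)"
  proof (intro exI [of _ C] conjI allI impI C)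
    fix W and a :: "real \<Rightarrow> complex" assume W: "finite W" "W \<subseteq> \<Omega>"
    define A where "A = (\<Sum>w\<in>W. (cmod (a w))\<^sup>2)"
    have A: "A \<ge> 0" unfolding A_def by (intro sum_nonneg) auto
    have near: "\<bar>energy T W a - T * A\<bar> \<le> T0 / 2 * A"
      unfolding A_def using energy_near_diagonal [OF W(1), of T "T0 / 4" a] small [OF W] T assms(1)
      by simp
    have "T0 * A \<le> T * A" using T A by (intro mult_right_mono) auto
    then have lo: "T0 / 2 * A \<le> energy T W a" and up: "energy T W a \<le> 2 * T * A"
      using near A unfolding abs_le_iff by linarith+
    have "1 * A \<le> C * (T0 / 2) * A" using C A by (intro mult_right_mono) auto
    also have "\<dots> \<le> C * energy T W a" using C lo by simp
    finally show "(\<Sum>w\<in>W. (cmod (a w))\<^sup>2) \<le> C * energy T W a" by (simp add: A_def)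
    show "energy T W a \<le> C * (\<Sum>w\<in>W. (cmod (a w))\<^sup>2)"
      using up mult_right_mono [OF C(3) A] by (simp add: A_def)
  qed
qed

section \<open>Inserting finitely many frequencies\<close>

lemma sin_less_arg:
  fixes y :: real
  assumes "y > 0"
  shows "sin y < y"
proof (cases "y \<le> 1")
  case True
  obtain z where z: "0 < z" "z < y" "sin y - sin 0 = (y - 0) * cos z"
    using MVT2 [OF assms, of sin cos] by (auto intro: derivative_eq_intros)
  have "cos z < cos 0"
    using z True pi_gt3 by (intro cos_monotone_0_pi) auto
  then have "y * cos z < y * 1"
    using assms by (intro mult_strict_left_mono) auto
  with z show ?thesis by simp
next
  case False
  then show ?thesis using sin_le_one [of y] by linarith
qed

text \<open>Compactness gives the gap on a bounded interval, and beyond 2 the quotient is at most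
  1/2. The gap bounds the mean square of \<open>1 - cis (x * s)\<close> from below, uniformly for
  large \<open>|x|\<close>.\<close>

lemma sinc_bounded_away:
  assumes "x0 > (0::real)"
  obtains c where "c > 0" "\<And>x. \<bar>x\<bar> \<ge> x0 \<Longrightarrow> sin x / x \<le> 1 - c"
proof -
  have *: "\<exists>c>0. \<forall>x\<in>{x0..max x0 2}. sin x / x \<le> 1 - c"
  proof -
    have "continuous_on {x0..max x0 2} (\<lambda>x. sin x / x)"
      using assms by (intro continuous_intros) auto
    then obtain y where y: "y \<in> {x0..max x0 2}" "\<And>x. x \<in> {x0..max x0 2} \<Longrightarrow> sin x / x \<le> sin y / y"
      using continuous_attains_sup [of "{x0..max x0 2}" "\<lambda>x. sin x / x"] by auto
    have "sin y < y" using sin_less_arg [of y] y assms by auto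
    then have "sin y / y < 1" using y assms by (simp add: divide_less_eq)
    then show ?thesis using y by (intro exI [of _ "1 - sin y / y"]) auto
  qed
  then obtain c where c: "c > 0" "\<And>x. x \<in> {x0..max x0 2} \<Longrightarrow> sin x / x \<le> 1 - c" by blast
  have pos: "sin x / x \<le> 1 - min c (1/2)" if "x \<ge> x0" for x
  proof (cases "x \<le> max x0 2")
    case True
    then show ?thesis using c(2) [of x] that by auto
  next
    case False
    then have "sin x / x \<le> 1 / x" by (intro divide_right_mono) auto
    also have "\<dots> \<le> 1 / 2" using False by (intro divide_left_mono) auto
    finally show ?thesis by linarith
  qed
  show ?thesis
  proof (rule that [of "min c (1/2)"])
    fix x assume "\<bar>x\<bar> \<ge> x0"
    then show "sin x / x \<le> 1 - min c (1/2)"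
      using pos [of x] pos [of "- x"] by (cases "x \<ge> 0") auto
  qed (use c in auto)
qed

lemma integrable_on_exp_sum_shift:
  "(\<lambda>t. (cmod (exp_sum W a (t + s)))\<^sup>2) integrable_on {c..d}"
  by (intro integrable_continuous_interval continuous_intros)

lemma energy_shift_le:
  assumes "0 \<le> s" "s + T' \<le> T"
  shows "integral {0..T'} (\<lambda>t. (cmod (exp_sum W a (t + s)))\<^sup>2) \<le> energy T W a"
proof -
  have "integral {0..T'} (\<lambda>t. (cmod (exp_sum W a (t + s)))\<^sup>2) =
      integral {s..T'+s} (\<lambda>t. (cmod (exp_sum W a t))\<^sup>2)"
    using integral_shift_real_ivl [of s s "T'+s" "\<lambda>t. (cmod (exp_sum W a t))\<^sup>2"] by simp
  also have "\<dots> \<le> energy T W a"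
    unfolding energy_def using assms by (intro integral_subset_le integrable_on_exp_sum) auto
  finally show ?thesis .
qed

lemma integral_norm_one_minus_cis:
  assumes "x \<noteq> 0" "d > 0"
  shows "((\<lambda>s. (cmod (1 - cis (x * s)))\<^sup>2) has_integral 2 * d * (1 - sin (x * d) / (x * d))) {0..d}"
proof -
  have eq: "(cmod (1 - cis y))\<^sup>2 = 2 - 2 * cos y" for y
    by (simp add: cmod_power2 power2_diff)
  have "((\<lambda>s. 2 - 2 * cos (x * s)) has_integral
      (2 * d - 2 * sin (x * d) / x) - (2 * 0 - 2 * sin (x * 0) / x)) {0..d}"
    using assms
    by (intro fundamental_theorem_of_calculus)
       (auto intro!: derivative_eq_intros simp flip: has_real_derivative_iff_has_vector_derivative)
  then show ?thesis
    using assms by (simp add: eq right_diff_distrib)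
qed

text \<open>
  The difference \<open>f(t) - e\<^bsup>-i w0 s\<^esup> f(t + s)\<close> removes the frequency \<open>w0\<close> and multiplies the
  coefficient at \<open>w\<close> by \<open>1 - e\<^bsup>i (w - w0) s\<^esup>\<close>; the mean square of this factor over \<open>0 \<le> s \<le> \<delta>\<close> is
  bounded below when \<open>w\<close> stays away from \<open>w0\<close>.
\<close>

lemma riesz_insert_isolated:
  assumes "riesz T0 \<Omega>" "T0 \<ge> 0" "d > 0" and far: "\<And>w. w \<in> \<Omega> \<Longrightarrow> d \<le> \<bar>w - w0\<bar>"
  shows "riesz T0 (insert w0 \<Omega>)"
  unfolding riesz_def
proof (intro allI impI)
  fix T assume T: "T > T0"
  \<comment> \<open>The midpoint divides the surplus \<open>T - T0\<close>: the lower bound for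
    \<open>\<Omega>\<close> is applied on \<open>[0, T']\<close>, and shifts up to
    \<open>\<delta>\<close> stay inside \<open>[0, T]\<close>.\<close>
  define T' where "T' = (T0 + T) / 2"
  define \<delta> where "\<delta> = T - T'"
  have T': "T' > T0" "\<delta> > 0" "T' + \<delta> = T" "T > 0" "T' < T"
    using T assms(2) by (auto simp: T'_def \<delta>_def field_simps)
  obtain C' where C': "C' > 0" "\<And>W a. finite W \<Longrightarrow> W \<subseteq> \<Omega> \<Longrightarrow> (\<Sum>w\<in>W. (cmod (a w))\<^sup>2) \<le> C' * energy T' W a"
    using assms(1) T'(1) unfolding riesz_def by meson
  obtain C where C: "C > 0" "\<And>W a. finite W \<Longrightarrow> W \<subseteq> \<Omega> \<Longrightarrow> energy T W a \<le> C * (\<Sum>w\<in>W. (cmod (a w))\<^sup>2)"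
    using assms(1) T unfolding riesz_def by meson
  obtain c where c: "c > 0" "\<And>x. \<bar>x\<bar> \<ge> d * \<delta> \<Longrightarrow> sin x / x \<le> 1 - c"
    using sinc_bounded_away [of "d * \<delta>"] assms(3) T' by auto
  define B where "B = 2 * C' / c"
  \<comment> \<open>The first three terms serve the lower bound (coefficient at \<open>w0\<close>,
    then the rest), the last two the upper bound.\<close>
  define D where "D = 2 / T + 2 * C * B / T + B + 2 * T + 2 * C"
  have B: "B > 0" using C' c by (simp add: B_def)
  have D: "D > 0" unfolding D_def using C B T' by (intro add_pos_pos) auto
  show "\<exists>C>0. \<forall>W a. finite W \<longrightarrow> W \<subseteq> insert w0 \<Omega> \<longrightarrow>
     (\<Sum>w\<in>W. (cmod (a w))\<^sup>2) \<le> C * energy T W a \<and> energy T W a \<le> C * (\<Sum>w\<in>W. (cmod (a w))\<^sup>2)"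
  proof (intro exI [of _ D] conjI D allI impI)
    fix W and a :: "real \<Rightarrow> complex" assume W: "finite W" "W \<subseteq> insert w0 \<Omega>"
    define V where "V = W - {w0}"
    define A where "A = (if w0 \<in> W then a w0 else 0)"
    define S where "S = (\<Sum>w\<in>V. (cmod (a w))\<^sup>2)"
    define E where "E = energy T W a"
    have V: "finite V" "V \<subseteq> \<Omega>" using W by (auto simp: V_def)
    have S: "S \<ge> 0" unfolding S_def by (intro sum_nonneg) auto
    have E: "E \<ge> 0" unfolding E_def by (rule energy_nonneg)
    have split: "exp_sum W a t = A * cis (w0 * t) + exp_sum V a t" for t
    proof (cases "w0 \<in> W")
      case True
      then show ?thesis using W(1) by (simp add: exp_sum_def V_def A_def sum.remove)
    next
      case False
      then show ?thesis by (simp add: exp_sum_def V_def A_def)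
    qed
    have sumW: "(\<Sum>w\<in>W. (cmod (a w))\<^sup>2) = (cmod A)\<^sup>2 + S"
    proof (cases "w0 \<in> W")
      case True
      then show ?thesis using W(1) by (simp add: S_def V_def A_def sum.remove)
    next
      case False
      then show ?thesis by (simp add: S_def V_def A_def)
    qed
    have "(\<Sum>w\<in>V. (cmod (a w))\<^sup>2 * (cmod (1 - cis ((w - w0) * s)))\<^sup>2) \<le> 4 * C' * E" if s: "s \<in> {0..\<delta>}" for s
    proof -
      define b where "b = (\<lambda>w. a w * (1 - cis ((w - w0) * s)))"
      have b: "exp_sum V b t = exp_sum W a t - cis (- w0 * s) * exp_sum W a (t + s)" for t
      proof -
        have "exp_sum V b t = exp_sum V a t - (\<Sum>w\<in>V. a w * cis ((w - w0) * s) * cis (w * t))"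
          by (simp add: exp_sum_def b_def sum_subtractf algebra_simps)
        also have "(\<Sum>w\<in>V. a w * cis ((w - w0) * s) * cis (w * t)) = cis (- w0 * s) * exp_sum V a (t + s)"
          unfolding exp_sum_def sum_distrib_left
          by (intro sum.cong refl) (simp add: cis_mult algebra_simps)
        also have "exp_sum V a t - \<dots> = exp_sum W a t - cis (- w0 * s) * exp_sum W a (t + s)"
          by (simp add: split cis_mult algebra_simps)
        finally show ?thesis .
      qed
      have "(\<Sum>w\<in>V. (cmod (a w))\<^sup>2 * (cmod (1 - cis ((w - w0) * s)))\<^sup>2) = (\<Sum>w\<in>V. (cmod (b w))\<^sup>2)"
        by (simp add: b_def norm_mult power_mult_distrib)
      also have "\<dots> \<le> C' * energy T' V b" using C' V by blast
      also have "energy T' V b \<le> integral {0..T'}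
          (\<lambda>t. 2 * (cmod (exp_sum W a t))\<^sup>2 + 2 * (cmod (exp_sum W a (t + s)))\<^sup>2)"
        unfolding energy_def
      proof (intro integral_le integrable_on_exp_sum)
        show "(\<lambda>t. 2 * (cmod (exp_sum W a t))\<^sup>2 + 2 * (cmod (exp_sum W a (t + s)))\<^sup>2) integrable_on {0..T'}"
          by (intro integrable_continuous_interval continuous_intros)
        show "(cmod (exp_sum V b t))\<^sup>2 \<le> 2 * (cmod (exp_sum W a t))\<^sup>2 + 2 * (cmod (exp_sum W a (t + s)))\<^sup>2" for t
          unfolding b using cmod_diff_sq_le [of "exp_sum W a t" "cis (- w0 * s) * exp_sum W a (t + s)"]
          by (simp add: norm_mult)
      qed
      also have "\<dots> = 2 * integral {0..T'} (\<lambda>t. (cmod (exp_sum W a t))\<^sup>2) +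
          2 * integral {0..T'} (\<lambda>t. (cmod (exp_sum W a (t + s)))\<^sup>2)"
        by (subst integral_add)
           (auto intro!: integrable_on_exp_sum integrable_on_exp_sum_shift integrable_on_cmult_left)
      also have "\<dots> \<le> 2 * E + 2 * E"
        unfolding E_def using s T' energy_shift_le [of 0 T' T W a] energy_shift_le [of s T' T W a]
        by (intro add_mono mult_left_mono) auto
      finally show ?thesis using C' by simp
    qed
    \<comment> \<open>A single shift \<open>s\<close> may annihilate some \<open>w\<close>, namely
      when \<open>(w - w0) * s\<close> is a multiple of \<open>2 * pi\<close>; averaging over
      \<open>s\<close> excludes this for all \<open>w\<close> at once.\<close>
    then have "integral {0..\<delta>} (\<lambda>s. \<Sum>w\<in>V. (cmod (a w))\<^sup>2 * (cmod (1 - cis ((w - w0) * s)))\<^sup>2)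
        \<le> integral {0..\<delta>} (\<lambda>s. 4 * C' * E)"
      by (intro integral_le integrable_continuous_interval continuous_intros) auto
    also have "\<dots> = \<delta> * (4 * C' * E)" using T' by simp
    also have "integral {0..\<delta>} (\<lambda>s. \<Sum>w\<in>V. (cmod (a w))\<^sup>2 * (cmod (1 - cis ((w - w0) * s)))\<^sup>2) =
        (\<Sum>w\<in>V. (cmod (a w))\<^sup>2 * (2 * \<delta> * (1 - sin ((w - w0) * \<delta>) / ((w - w0) * \<delta>))))"
      using V far assms(3) T'
      by (intro integral_unique has_integral_sum has_integral_mult_right integral_norm_one_minus_cis)
         fastforce+
    finally have up: "(\<Sum>w\<in>V. (cmod (a w))\<^sup>2 * (2 * \<delta> * (1 - sin ((w - w0) * \<delta>) / ((w - w0) * \<delta>))))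
        \<le> \<delta> * (4 * C' * E)" .
    have "(\<Sum>w\<in>V. (cmod (a w))\<^sup>2 * (2 * \<delta> * c)) \<le>
        (\<Sum>w\<in>V. (cmod (a w))\<^sup>2 * (2 * \<delta> * (1 - sin ((w - w0) * \<delta>) / ((w - w0) * \<delta>))))"
    proof (intro sum_mono mult_left_mono)
      fix w assume "w \<in> V"
      then have "d * \<delta> \<le> \<bar>(w - w0) * \<delta>\<bar>"
        unfolding abs_mult using far [of w] V T' by (intro mult_mono) auto
      from c(2) [OF this] show "c \<le> 1 - sin ((w - w0) * \<delta>) / ((w - w0) * \<delta>)" by linarith
    qed (use T' in auto)
    also note up
    also have "(\<Sum>w\<in>V. (cmod (a w))\<^sup>2 * (2 * \<delta> * c)) = 2 * \<delta> * (c * S)"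
      by (simp add: S_def sum_distrib_right [symmetric])
    finally have "2 * \<delta> * (c * S) \<le> 2 * \<delta> * (2 * C' * E)"
      by simp
    then have "c * S \<le> 2 * C' * E" using T'(2) by (metis mult_le_cancel_left_pos mult_2 add_pos_pos)
    then have SB: "S \<le> B * E" using c by (simp add: B_def field_simps)
    have EV: "energy T V a \<le> C * S" unfolding S_def using C V by blast
    have int2: "integral {0..T} (\<lambda>t. 2 * f t + 2 * (cmod (exp_sum V a t))\<^sup>2) =
          2 * integral {0..T} f + 2 * energy T V a" if "f integrable_on {0..T}" for f
      unfolding energy_def using that
      by (subst integral_add) (auto intro!: integrable_on_exp_sum integrable_on_cmult_left)
    \<comment> \<open>The coefficient at \<open>w0\<close> is what remains after subtracting the sum
      over \<open>V\<close>, whose energy is controlled by the upper bound for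
      \<open>\<Omega>\<close> and the estimate of \<open>S\<close> just obtained.\<close>
    have "T * (cmod A)\<^sup>2 = integral {0..T} (\<lambda>t. (cmod A)\<^sup>2)" using T' by simp
    also have "\<dots> \<le> integral {0..T} (\<lambda>t. 2 * (cmod (exp_sum W a t))\<^sup>2 + 2 * (cmod (exp_sum V a t))\<^sup>2)"
    proof (intro integral_le integrable_continuous_interval continuous_intros)
      fix t
      have "A * cis (w0 * t) = exp_sum W a t - exp_sum V a t" by (simp add: split)
      then have "cmod A = cmod (exp_sum W a t - exp_sum V a t)"
        by (metis mult.right_neutral norm_cis norm_mult)
      then show "(cmod A)\<^sup>2 \<le> 2 * (cmod (exp_sum W a t))\<^sup>2 + 2 * (cmod (exp_sum V a t))\<^sup>2"
        using cmod_diff_sq_le by metis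
    qed
    also have "\<dots> = 2 * E + 2 * energy T V a"
      unfolding E_def energy_def [of T W] by (rule int2 [OF integrable_on_exp_sum])
    also have "\<dots> \<le> 2 * E + 2 * (C * (B * E))"
      using EV SB C by (intro add_mono mult_left_mono order_trans [OF EV]) auto
    finally have "(cmod A)\<^sup>2 \<le> (2 / T + 2 * C * B / T) * E"
      using T' by (simp add: field_simps)
    then have "(cmod A)\<^sup>2 + S \<le> (2 / T + 2 * C * B / T + B) * E"
      using SB by (simp add: distrib_right)
    also have "\<dots> \<le> D * E"
      unfolding D_def using C T' by (intro mult_right_mono E) auto
    finally show "(\<Sum>w\<in>W. (cmod (a w))\<^sup>2) \<le> D * energy T W a"
      unfolding sumW E_def .
    have "E \<le> integral {0..T} (\<lambda>t. 2 * (cmod A)\<^sup>2 + 2 * (cmod (exp_sum V a t))\<^sup>2)"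
      unfolding E_def energy_def
    proof (intro integral_le integrable_on_exp_sum)
      fix t
      show "(cmod (exp_sum W a t))\<^sup>2 \<le> 2 * (cmod A)\<^sup>2 + 2 * (cmod (exp_sum V a t))\<^sup>2"
        unfolding split using cmod_add_sq_le [of "A * cis (w0 * t)"] by (simp add: norm_mult)
    qed (intro integrable_continuous_interval continuous_intros)
    also have "\<dots> = 2 * (T * (cmod A)\<^sup>2) + 2 * energy T V a"
      using int2 [OF integrable_const_ivl, of "(cmod A)\<^sup>2"] T' by simp
    also have "\<dots> \<le> 2 * T * (cmod A)\<^sup>2 + 2 * C * S" using EV by simp
    also have "\<dots> \<le> D * (cmod A)\<^sup>2 + D * S"
      using C T' B S by (intro add_mono mult_right_mono) (auto simp: D_def)
    finally show "energy T W a \<le> D * (\<Sum>w\<in>W. (cmod (a w))\<^sup>2)"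
      by (simp add: sumW E_def distrib_left)
  qed
qed

text \<open>Local finiteness supplies the isolation: only finitely many frequencies lie within
  distance 1 of the new one, so the minimum of 1 and their distances is a positive gap.\<close>

lemma riesz_union_finite:
  assumes "riesz T0 \<Omega>" "T0 \<ge> 0" "finite F"
    and "\<And>R. finite {w\<in>\<Omega>. \<bar>w\<bar> \<le> R}"
  shows "riesz T0 (F \<union> \<Omega>)"
  using assms(3)
proof (induction F rule: finite_induct)
  case empty
  then show ?case using assms(1) by simp
next
  case (insert w0 F)
  show ?case
  proof (cases "w0 \<in> \<Omega>")
    case True
    then show ?thesis using insert by (simp add: insert_absorb)
  next
    case False
    let ?S = "F \<union> {w\<in>\<Omega>. \<bar>w\<bar> \<le> \<bar>w0\<bar> + 1}"
    obtain d where d: "d > 0" "\<And>w. w \<in> ?S \<Longrightarrow> w \<noteq> w0 \<Longrightarrow> d \<le> dist w0 w"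
      using finite_set_avoid [of ?S w0] assms(4) insert.hyps by blast
    have "riesz T0 (insert w0 (F \<union> \<Omega>))"
    proof (rule riesz_insert_isolated [OF insert.IH assms(2), of "min d 1"])
      fix w assume w: "w \<in> F \<union> \<Omega>"
      then have "w \<noteq> w0" using insert.hyps False by auto
      show "min d 1 \<le> \<bar>w - w0\<bar>"
      proof (cases "w \<in> ?S")
        case True
        then show ?thesis using d(2) [of w] \<open>w \<noteq> w0\<close> by (simp add: dist_real_def abs_minus_commute)
      next
        case False
        then have "\<bar>w\<bar> > \<bar>w0\<bar> + 1" using w by auto
        then show ?thesis by linarith
      qed
    qed (use d in auto)
    then show ?thesis by simp
  qed
qed

theorem riesz_of_sparse_tails:
  assumes "T > 0"
    and fin: "\<And>R. finite {w\<in>\<Omega>. \<bar>w\<bar> \<le> R}"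
    and tails: "\<And>e. e > 0 \<Longrightarrow> \<exists>F. finite F \<and> (\<forall>W w. finite W \<longrightarrow> W \<subseteq> \<Omega> - F \<longrightarrow> w \<in> W \<longrightarrow>
        (\<Sum>w'\<in>W. 1 / \<bar>w - w'\<bar>) \<le> e)"
  shows "\<exists>C>0. \<forall>W a. finite W \<longrightarrow> W \<subseteq> \<Omega> \<longrightarrow>
     (\<Sum>w\<in>W. (cmod (a w))\<^sup>2) \<le> C * energy T W a \<and> energy T W a \<le> C * (\<Sum>w\<in>W. (cmod (a w))\<^sup>2)"
proof -
  \<comment> \<open>Half the length is used as threshold \<open>T0\<close>, since
    \<open>riesz\<close> speaks only about lengths strictly above it; the further 4 is the one in
    \<open>riesz_sparse\<close>.\<close>
  obtain F where F: "finite F" "\<And>W w. finite W \<Longrightarrow> W \<subseteq> \<Omega> - F \<Longrightarrow> w \<in> W \<Longrightarrow>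
        (\<Sum>w'\<in>W. 1 / \<bar>w - w'\<bar>) \<le> T / 2 / 4"
    using tails [of "T / 2 / 4"] assms(1) by auto
  have "riesz (T / 2) (\<Omega> - F)"
    using F assms(1) by (intro riesz_sparse) auto
  then have "riesz (T / 2) (F \<inter> \<Omega> \<union> (\<Omega> - F))"
    using F(1) assms(1) by (intro riesz_union_finite) (auto intro: finite_subset [OF _ fin])
  moreover have "F \<inter> \<Omega> \<union> (\<Omega> - F) = \<Omega>" by auto
  ultimately show ?thesis
    unfolding riesz_def using assms(1) by simp
qed

section \<open>Frequencies along a line\<close>

definition freq :: "nat \<Rightarrow> real \<Rightarrow> int \<Rightarrow> real" where
  "freq l v k = dispersion l k - of_int k * v"

text \<open>All differences of even powers have the sign of \<open>k^2 - m^2\<close>, so nothing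
  cancels and the terms \<open>j = 1, 2\<close> alone give the bound; their sum factors as stated.
  Both terms are present because \<open>l > 1\<close>.\<close>

lemma dispersion_diff_ge:
  fixes k m :: int
  assumes "l > 1"
  shows "\<bar>(of_int k)\<^sup>2 - (of_int m)\<^sup>2\<bar> * (1 + (of_int k)\<^sup>2 + (of_int m)\<^sup>2) \<le> \<bar>dispersion l k - dispersion l m\<bar>"
proof -
  have *: "((of_int k)\<^sup>2 - (of_int m)\<^sup>2) * (1 + (of_int k)\<^sup>2 + (of_int m)\<^sup>2) \<le> dispersion l k - dispersion l m"
    if le: "(of_int m)\<^sup>2 \<le> ((of_int k)\<^sup>2 :: real)" for k m :: int
  proof -
    let ?f = "\<lambda>j. (of_int k :: real) ^ (2 * j) - of_int m ^ (2 * j)"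
    have "((of_int k)\<^sup>2 - (of_int m)\<^sup>2 :: real) * (1 + (of_int k)\<^sup>2 + (of_int m)\<^sup>2) = (\<Sum>j\<in>{1,2}. ?f j)"
      by (simp add: algebra_simps power2_eq_square power4_eq_xxxx)
    also have "\<dots> \<le> (\<Sum>j=1..l. ?f j)"
      using assms le by (intro sum_mono2) (auto simp: power_mult intro!: power_mono)
    finally show ?thesis by (simp add: dispersion_def sum_subtractf)
  qed
  show ?thesis
  proof (cases "(of_int m)\<^sup>2 \<le> ((of_int k)\<^sup>2 :: real)")
    case True
    with * [OF True] show ?thesis by simp
  next
    case False
    then have "(of_int k)\<^sup>2 \<le> ((of_int m)\<^sup>2 :: real)" by simp
    from * [OF this] this show ?thesis by (simp add: algebra_simps)
  qed
qed

lemma dispersion_minus [simp]: "dispersion l (- k) = dispersion l k"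
  by (simp add: dispersion_def)

lemma dispersion_ge_square:
  assumes "l > 1"
  shows "(of_int k)\<^sup>2 \<le> dispersion l k"
proof -
  have "(\<Sum>j\<in>{1}. (of_int k :: real) ^ (2 * j)) \<le> dispersion l k"
    unfolding dispersion_def using assms by (intro sum_mono2) auto
  then show ?thesis by simp
qed

text \<open>Both integer factors \<open>|k - m|\<close> and \<open>|k + m|\<close> are at least 1,
  and the drift \<open>|k - m| * |v|\<close> is absorbed by the summand \<open>k^2\<close>. The
  bound is left in terms of \<open>m\<close> alone so that its reciprocals can be summed over
  \<open>m\<close> uniformly in \<open>k\<close>.\<close>

lemma freq_diff_ge:
  assumes "l > 1" "k \<noteq> m" "k \<noteq> - m" "\<bar>v\<bar> \<le> (of_int k)\<^sup>2"
  shows "(of_int m)\<^sup>2 + 1 \<le> \<bar>freq l v k - freq l v m\<bar>"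
proof -
  let ?k = "of_int k :: real" and ?m = "of_int m :: real"
  have "\<bar>k - m\<bar> \<ge> 1" "\<bar>k + m\<bar> \<ge> 1" using assms by auto
  then have ge: "\<bar>?k - ?m\<bar> \<ge> 1" "\<bar>?k + ?m\<bar> \<ge> 1"
    by (simp_all flip: of_int_diff of_int_add of_int_abs)
  have "?m\<^sup>2 + 1 \<le> 1 * (1 * (1 + ?k\<^sup>2 + ?m\<^sup>2) - \<bar>v\<bar>)"
    using assms by simp
  also have "\<dots> \<le> \<bar>?k - ?m\<bar> * (\<bar>?k + ?m\<bar> * (1 + ?k\<^sup>2 + ?m\<^sup>2) - \<bar>v\<bar>)"
  proof (rule mult_mono)
    have "0 \<le> 1 + ?k\<^sup>2 + ?m\<^sup>2" by simp
    with ge(2) show "1 * (1 + ?k\<^sup>2 + ?m\<^sup>2) - \<bar>v\<bar> \<le> \<bar>?k + ?m\<bar> * (1 + ?k\<^sup>2 + ?m\<^sup>2) - \<bar>v\<bar>"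
      by (intro diff_mono mult_right_mono) auto
    show "0 \<le> 1 * (1 + ?k\<^sup>2 + ?m\<^sup>2) - \<bar>v\<bar>"
      using assms(4) zero_le_power2 [of ?m] by (simp only: mult_1)
  qed (use ge in auto)
  also have "\<dots> = \<bar>?k\<^sup>2 - ?m\<^sup>2\<bar> * (1 + ?k\<^sup>2 + ?m\<^sup>2) - \<bar>?k - ?m\<bar> * \<bar>v\<bar>"
  proof -
    have "\<bar>?k\<^sup>2 - ?m\<^sup>2\<bar> = \<bar>?k - ?m\<bar> * \<bar>?k + ?m\<bar>"
      by (simp add: power2_eq_square square_diff_square_factored abs_mult)
    then show ?thesis by (simp only: right_diff_distrib mult.assoc)
  qed
  also have "\<dots> \<le> \<bar>dispersion l k - dispersion l m\<bar> - \<bar>(?k - ?m) * v\<bar>"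
    using dispersion_diff_ge [OF assms(1), of k m] by (simp add: abs_mult)
  also have "\<dots> \<le> \<bar>(dispersion l k - dispersion l m) - (?k - ?m) * v\<bar>"
    by linarith
  also have "\<dots> = \<bar>freq l v k - freq l v m\<bar>"
    by (simp add: freq_def algebra_simps)
  finally show ?thesis .
qed

lemma finite_freq_le:
  assumes "l > 1"
  shows "finite {k. \<bar>freq l v k\<bar> \<le> R}"
proof (rule finite_subset)
  show "{k. \<bar>freq l v k\<bar> \<le> R} \<subseteq> {- \<lceil>R + \<bar>v\<bar>\<rceil> - 1..\<lceil>R + \<bar>v\<bar>\<rceil> + 1}"
  proof
    fix k assume "k \<in> {k. \<bar>freq l v k\<bar> \<le> R}"
    then have k: "\<bar>freq l v k\<bar> \<le> R" by simp
    have "\<bar>of_int k\<bar> \<le> R + \<bar>v\<bar> + 1"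
    proof (rule ccontr)
      assume "\<not> ?thesis"
      then have big: "\<bar>of_int k\<bar> > R + \<bar>v\<bar> + 1" by simp
      have R: "R \<ge> 0" using k by linarith
      have "R \<le> 1 * (R + 1)" by simp
      also have "\<dots> < \<bar>of_int k\<bar> * (\<bar>of_int k\<bar> - \<bar>v\<bar>)"
        using big R by (intro mult_strict_mono) auto
      also have "\<dots> = (of_int k)\<^sup>2 - \<bar>of_int k * v\<bar>"
        by (simp add: abs_mult algebra_simps power2_eq_square)
      also have "\<dots> \<le> dispersion l k - \<bar>of_int k * v\<bar>"
        using dispersion_ge_square [OF assms] by simp
      also have "\<dots> \<le> \<bar>freq l v k\<bar>" unfolding freq_def by linarith
      finally show False using k by simp
    qed
    then show "k \<in> {- \<lceil>R + \<bar>v\<bar>\<rceil> - 1..\<lceil>R + \<bar>v\<bar>\<rceil> + 1}"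
      by (auto simp: abs_le_iff) linarith+
  qed
qed auto

section \<open>Row sums of inverse frequency gaps\<close>

lemma sum_inverse_squares_tail:
  fixes N n :: nat
  assumes "N \<ge> 1" "n \<ge> N"
  shows "(\<Sum>m\<in>{N<..n}. 1 / (real m)\<^sup>2) \<le> 1 / N - 1 / n"
  using assms(2)
proof (induction n rule: dec_induct)
  case (step j)
  have "{N<..Suc j} = insert (Suc j) {N<..j}" using step by auto
  then have "(\<Sum>m\<in>{N<..Suc j}. 1 / (real m)\<^sup>2) \<le> 1 / (real (Suc j))\<^sup>2 + (1 / N - 1 / j)"
    using step by simp
  also have "1 / (real (Suc j))\<^sup>2 \<le> 1 / (j * Suc j)"
    unfolding power2_eq_square of_nat_mult using step assms(1)
    by (intro divide_left_mono mult_right_mono mult_pos_pos) auto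
  also have "1 / (real (j * Suc j)) = 1 / j - 1 / Suc j"
    using step assms(1) by (simp add: field_simps)
  finally show ?case by simp
qed simp

lemma sum_inverse_squares_tail_int:
  fixes M :: "int set" and N :: nat
  assumes "finite M" "N \<ge> 1" and M: "\<And>m. m \<in> M \<Longrightarrow> \<bar>m\<bar> > int N"
  shows "(\<Sum>m\<in>M. 1 / (of_int m)\<^sup>2) \<le> 2 / real N"
proof -
  define n where "n = max N (nat (Max (abs ` M)))"
  have Mn: "\<bar>m\<bar> \<le> int n" if "m \<in> M" for m
  proof -
    have "\<bar>m\<bar> \<le> Max (abs ` M)" using that assms(1) by simp
    then show ?thesis unfolding n_def by linarith
  qed
  have "M \<subseteq> int ` {N<..n} \<union> (\<lambda>m. - int m) ` {N<..n}"
  proof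
    fix m assume "m \<in> M"
    then have "nat \<bar>m\<bar> \<in> {N<..n}" "m = int (nat \<bar>m\<bar>) \<or> m = - int (nat \<bar>m\<bar>)"
      using M [of m] Mn [of m] by auto
    then show "m \<in> int ` {N<..n} \<union> (\<lambda>m. - int m) ` {N<..n}" by blast
  qed
  then have "(\<Sum>m\<in>M. 1 / (of_int m)\<^sup>2) \<le>
      (\<Sum>m\<in>int ` {N<..n} \<union> (\<lambda>m. - int m) ` {N<..n}. 1 / (of_int m :: real)\<^sup>2)"
    by (intro sum_mono2) auto
  also have "\<dots> \<le> (\<Sum>m\<in>int ` {N<..n}. 1 / (of_int m)\<^sup>2) + (\<Sum>m\<in>(\<lambda>m. - int m) ` {N<..n}. 1 / (of_int m)\<^sup>2)"
    by (simp add: sum_Un sum_nonneg)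
  also have "\<dots> = 2 * (\<Sum>m\<in>{N<..n}. 1 / (real m)\<^sup>2)"
    by (subst (1 2) sum.reindex) (auto simp: inj_on_def)
  also have "\<dots> \<le> 2 * (1 / N - 1 / n)"
    using sum_inverse_squares_tail [of N n] assms(2) by (simp add: n_def)
  also have "\<dots> \<le> 2 / N" by simp
  finally show ?thesis .
qed

text \<open>The quadratic gap fails only between \<open>k\<close> and \<open>-k\<close>, at distance
  \<open>2 * |k| * |v|\<close>. Each frequency has just one such partner, so it adds a single term
  that is small for large \<open>|k|\<close>; the other terms form a tail of inverse
  squares.\<close>

lemma freq_sparse_tails:
  assumes "l > 1" "e > 0"
  shows "\<exists>F. finite F \<and> (\<forall>W w. finite W \<longrightarrow> W \<subseteq> range (freq l v) - F \<longrightarrow> w \<in> W \<longrightarrow>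
        (\<Sum>w'\<in>W. 1 / \<bar>w - w'\<bar>) \<le> e)"
proof -
  \<comment> \<open>\<open>N1\<close> gives \<open>|v| \<le> N\<close> and makes the inverse-square
    tail \<open>2 / N\<close> at most \<open>e / 2\<close>; \<open>N2\<close> does the same for the
    term of the mirror index. For \<open>v = 0\<close> that term is \<open>1 / 0 = 0\<close>, as the
    mirror frequency is then \<open>w\<close> itself.\<close>
  obtain N1 :: nat where N1: "real N1 > max (max 1 \<bar>v\<bar>) (4 / e)"
    using reals_Archimedean2 by blast
  obtain N2 :: nat where N2: "real N2 > 1 / (\<bar>v\<bar> * e)"
    using reals_Archimedean2 by blast
  define N where "N = max N1 N2"
  have N: "N \<ge> 1" "\<bar>v\<bar> \<le> N" "2 / N \<le> e / 2" "1 / (2 * N * \<bar>v\<bar>) \<le> e / 2"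
  proof -
    show "N \<ge> 1" "\<bar>v\<bar> \<le> N" using N1 by (auto simp: N_def)
    have "4 / e < N" using N1 by (auto simp: N_def)
    then show "2 / N \<le> e / 2" using assms(2) \<open>N \<ge> 1\<close> by (simp add: field_simps)
    have "1 / (\<bar>v\<bar> * e) < N" using N2 by (auto simp: N_def)
    then show "1 / (2 * N * \<bar>v\<bar>) \<le> e / 2"
      using assms(2) \<open>N \<ge> 1\<close> by (cases "v = 0") (auto simp: field_simps)
  qed
  show ?thesis
  proof (intro exI [of _ "freq l v ` {- int N..int N}"] conjI allI impI)
    fix W w assume W: "finite W" "W \<subseteq> range (freq l v) - freq l v ` {- int N..int N}" "w \<in> W"
    \<comment> \<open>The sum runs over frequencies, so one representative index per frequency is
      chosen. All indices up to \<open>N\<close> in modulus have had their frequencies removed,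
      hence every representative exceeds \<open>N\<close>.\<close>
    define \<kappa> where "\<kappa> = inv_into UNIV (freq l v)"
    have \<kappa>: "freq l v (\<kappa> w') = w'" "\<bar>\<kappa> w'\<bar> > int N" if "w' \<in> W" for w'
    proof -
      show 1: "freq l v (\<kappa> w') = w'" unfolding \<kappa>_def using that W by (intro f_inv_into_f) auto
      show "\<bar>\<kappa> w'\<bar> > int N"
      proof (rule ccontr)
        assume "\<not> ?thesis"
        then have "\<kappa> w' \<in> {- int N..int N}" by auto
        then have "w' \<in> freq l v ` {- int N..int N}" using 1 by (metis image_eqI)
        then show False using that W by blast
      qed
    qed
    have inj: "inj_on \<kappa> W" by (rule inj_on_inverseI) (rule \<kappa>)
    define k where "k = \<kappa> w"
    have kN: "\<bar>real_of_int k\<bar> \<ge> N"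
      using \<kappa>(2) [OF W(3)] by (simp add: k_def flip: of_int_abs)
    have vk: "\<bar>v\<bar> \<le> (of_int k)\<^sup>2"
    proof -
      have "\<bar>v\<bar> \<le> \<bar>real_of_int k\<bar> * 1" using N kN by simp
      also have "\<dots> \<le> \<bar>real_of_int k\<bar> * \<bar>real_of_int k\<bar>" using N kN by (intro mult_left_mono) auto
      finally show ?thesis by (simp add: power2_eq_square)
    qed
    have recip_le: "1 / \<bar>w - w'\<bar> \<le> 1 / (of_int (\<kappa> w'))\<^sup>2 + (if w' = freq l v (- k) then 1 / (2 * N * \<bar>v\<bar>) else 0)"
      if w': "w' \<in> W" for w'
    proof (cases "\<kappa> w' = k \<or> \<kappa> w' = - k")
      case True
      then consider "w' = w" | "w' = freq l v (- k)"
        using \<kappa>(1) w' W(3) unfolding k_def by metis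
      then show ?thesis
      proof cases
        case 2
        have "w = freq l v k" using \<kappa>(1) W(3) by (simp add: k_def)
        with 2 have "\<bar>w - w'\<bar> = 2 * \<bar>of_int k\<bar> * \<bar>v\<bar>"
          by (simp add: freq_def abs_mult)
        moreover have "1 / (2 * \<bar>of_int k\<bar> * \<bar>v\<bar>) \<le> 1 / (2 * N * \<bar>v\<bar>)"
        proof (cases "v = 0")
          case False
          then show ?thesis using N kN
            by (intro divide_left_mono mult_right_mono mult_pos_pos) auto
        qed simp
        ultimately show ?thesis using 2 by (simp add: add_increasing)
      qed (use N in auto)
    next
      case False
      have "(of_int (\<kappa> w'))\<^sup>2 + 1 \<le> \<bar>freq l v k - freq l v (\<kappa> w')\<bar>"
        using False by (intro freq_diff_ge assms vk) auto
      then have le: "(of_int (\<kappa> w'))\<^sup>2 \<le> \<bar>w - w'\<bar>"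
        using \<kappa>(1) w' W(3) by (simp add: k_def)
      have "\<kappa> w' \<noteq> 0" using \<kappa>(2) [OF w'] by auto
      then have "1 / \<bar>w - w'\<bar> \<le> 1 / (of_int (\<kappa> w'))\<^sup>2"
        using le by (intro divide_left_mono mult_pos_pos) (auto intro: less_le_trans [OF _ le])
      then show ?thesis by (auto intro: add_increasing2)
    qed
    have "(\<Sum>w'\<in>W. 1 / \<bar>w - w'\<bar>) \<le>
        (\<Sum>w'\<in>W. 1 / (of_int (\<kappa> w'))\<^sup>2) + (\<Sum>w'\<in>W. if w' = freq l v (- k) then 1 / (2 * N * \<bar>v\<bar>) else 0)"
      unfolding sum.distrib [symmetric] by (intro sum_mono recip_le)
    also have "(\<Sum>w'\<in>W. 1 / (of_int (\<kappa> w'))\<^sup>2) = (\<Sum>m\<in>\<kappa> ` W. 1 / (real_of_int m)\<^sup>2)"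
      by (simp add: sum.reindex [OF inj])
    also have "\<dots> \<le> 2 / N"
      using W(1) N(1) \<kappa>(2) by (intro sum_inverse_squares_tail_int) auto
    also have "(\<Sum>w'\<in>W. if w' = freq l v (- k) then 1 / (2 * N * \<bar>v\<bar>) else 0) \<le> 1 / (2 * N * \<bar>v\<bar>)"
      using W(1) by simp
    finally show "(\<Sum>w'\<in>W. 1 / \<bar>w - w'\<bar>) \<le> e"
      using N(3,4) by linarith
  qed auto
qed

lemma freq_ingham:
  assumes "l > 1" "T > 0"
  shows "\<exists>C>0. \<forall>W a. finite W \<longrightarrow> W \<subseteq> range (freq l v) \<longrightarrow>
     (\<Sum>w\<in>W. (cmod (a w))\<^sup>2) \<le> C * energy T W a \<and> energy T W a \<le> C * (\<Sum>w\<in>W. (cmod (a w))\<^sup>2)"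
proof (rule riesz_of_sparse_tails [OF assms(2)])
  fix R
  have "{w \<in> range (freq l v). \<bar>w\<bar> \<le> R} \<subseteq> freq l v ` {k. \<bar>freq l v k\<bar> \<le> R}" by auto
  then show "finite {w \<in> range (freq l v). \<bar>w\<bar> \<le> R}"
    using finite_freq_le [OF assms(1)] finite_surj by blast
qed (rule freq_sparse_tails [OF assms(1)])

section \<open>Strict convexity of the dispersion relation\<close>

lemma convex_dispersion_tail: "convex_on UNIV (\<lambda>x::real. \<Sum>j=2..l. x ^ (2 * j))"
proof (induction l)
  case (Suc l)
  then show ?case
    by (cases "2 \<le> Suc l") (simp_all add: convex_on_add convex_power_even convex_on_const del: power_Suc mult_Suc_right)
qed (simp add: convex_on_const)

text \<open>The quadratic term has secant slope \<open>j + m\<close>, strictly increasing in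
  \<open>j\<close>; the convex remainder contributes nondecreasing slopes. Secants are the right
  object because a resonance at speed \<open>v\<close> is a secant of slope
  \<open>v\<close>.\<close>

lemma dispersion_slope_strict_mono:
  fixes k k' m :: int
  assumes "l > 1" "k < k'" "k \<noteq> m" "k' \<noteq> m"
  shows "(dispersion l k - dispersion l m) / (of_int k - of_int m) <
         (dispersion l k' - dispersion l m) / (of_int k' - of_int m)"
proof -
  define R where "R = (\<lambda>x::real. \<Sum>j=2..l. x ^ (2 * j))"
  have conv: "convex_on UNIV R" unfolding R_def by (rule convex_dispersion_tail)
  have disp: "dispersion l j = (of_int j)\<^sup>2 + R (of_int j)" for j
  proof -
    have "{1..l} = insert 1 {2..l}" using assms(1) by auto
    then show ?thesis by (simp add: dispersion_def R_def)
  qed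
  have slope: "(dispersion l j - dispersion l m) / (of_int j - of_int m) =
      of_int j + of_int m + (R (of_int j) - R (of_int m)) / (of_int j - of_int m)" if "j \<noteq> m" for j

  proof -
    have "((of_int j)\<^sup>2 - (of_int m)\<^sup>2) / (of_int j - of_int m :: real) = of_int j + of_int m"
      using that by (simp add: power2_eq_square square_diff_square_factored)
    moreover have "dispersion l j - dispersion l m =
        ((of_int j)\<^sup>2 - (of_int m)\<^sup>2) + (R (of_int j) - R (of_int m))"
      by (simp add: disp)
    ultimately show ?thesis by (simp only: add_divide_distrib)
  qed
  have "(R (of_int k) - R (of_int m)) / (of_int k - of_int m) \<le>
        (R (of_int k') - R (of_int m)) / (of_int k' - of_int m)"
  proof -
    have sym: "(R x - R y) / (x - y) = (R y - R x) / (y - x)" for x y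
      using minus_divide_divide [of "R y - R x" "y - x"] by simp
    let ?k = "of_int k :: real" and ?k' = "of_int k' :: real" and ?m = "of_int m :: real"
    consider "m < k" | "k < m" "m < k'" | "k' < m" using assms by linarith
    then show ?thesis
    proof cases
      case 1
      then show ?thesis
        using convex_on_slope_le(1) [OF conv, of ?m ?k' ?k] assms
        by (simp add: sym [of ?k ?m] sym [of ?k' ?m])
    next
      case 2
      have "(R ?k - R ?m) / (?k - ?m) \<le> (R ?k - R ?k') / (?k - ?k')"
        using convex_on_slope_le(1) [OF conv, of ?k ?k' ?m] 2 by simp
      also have "\<dots> \<le> (R ?m - R ?k') / (?m - ?k')"
        using convex_on_slope_le(2) [OF conv, of ?k ?k' ?m] 2 by simp
      finally show ?thesis by (simp add: sym [of ?k' ?m])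
    next
      case 3
      then show ?thesis
        using convex_on_slope_le(2) [OF conv, of ?k ?m ?k'] assms by simp
    qed
  qed
  moreover have "(of_int k :: real) < of_int k'" using assms by simp
  ultimately show ?thesis unfolding slope [OF assms(3)] slope [OF assms(4)] by linarith
qed

section \<open>Observability of finite sums\<close>

definition line_energy :: "real \<Rightarrow> nat \<Rightarrow> real \<Rightarrow> (int \<Rightarrow> complex) \<Rightarrow> int set \<Rightarrow> real" where
  "line_energy T l v a K = integral {0..T} (\<lambda>t. (cmod (\<Sum>k\<in>K. a k * cis (freq l v k * t)))\<^sup>2)"

lemma line_energy_nonneg: "line_energy T l v a K \<ge> 0"
  unfolding line_energy_def
  by (intro integral_nonneg integrable_continuous_interval continuous_intros) auto

lemma line_energy_eq:
  assumes "finite K"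
  shows "line_energy T l v a K =
    energy T (freq l v ` K) (\<lambda>w. \<Sum>k\<in>{k\<in>K. freq l v k = w}. a k)"
proof -
  have "(\<Sum>k\<in>K. a k * cis (freq l v k * t)) =
      exp_sum (freq l v ` K) (\<lambda>w. \<Sum>k\<in>{k\<in>K. freq l v k = w}. a k) t" for t
    unfolding exp_sum_def
    by (subst sum.image_gen [OF assms, of _ "freq l v"]) (auto simp: sum_distrib_right intro!: sum.cong)
  then show ?thesis by (simp add: line_energy_def energy_def)
qed

lemma dispersion_slope_if_freq_eq:
  assumes "freq l v j = freq l v m" "j \<noteq> m"
  shows "(dispersion l j - dispersion l m) / (of_int j - of_int m) = v"
proof -
  have "dispersion l j - dispersion l m = v * (of_int j - of_int m)"
    using assms(1) by (simp add: freq_def algebra_simps)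
  then show ?thesis using assms(2) by simp
qed

text \<open>Both \<open>k\<close> and \<open>k'\<close> would be ends of secants from
  \<open>m\<close> with the same slope \<open>v\<close>, which strict monotonicity of slopes forbids
  unless they agree.\<close>

lemma freq_class_unique:
  assumes "l > 1" "freq l v k = freq l v m" "freq l v k' = freq l v m" "k \<noteq> m" "k' \<noteq> m"
  shows "k = k'"
  using dispersion_slope_strict_mono [OF assms(1), of k k' m]
      dispersion_slope_strict_mono [OF assms(1), of k' k m] assms dispersion_slope_if_freq_eq [of l v k m]
      dispersion_slope_if_freq_eq [of l v k' m]
  by (cases k k' rule: linorder_cases) auto

text \<open>The secants from \<open>m\<close> to \<open>k\<close> and to \<open>k'\<close> have
  slopes \<open>v2\<close> and \<open>v1\<close>, and slopes are ordered like the end points. The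
  factor \<open>v2 - v1\<close> covers both orders of the speeds.\<close>

lemma freq_chain_monotone:
  assumes "l > 1" "v1 \<noteq> v2" "k \<noteq> m" "k' \<noteq> m"
    and "freq l v2 k = freq l v2 m" "freq l v1 k' = freq l v1 m"
  shows "(v2 - v1) * of_int k' < (v2 - v1) * of_int k"
proof -
  have eq: "(dispersion l k - dispersion l m) / (of_int k - of_int m) = v2"
    "(dispersion l k' - dispersion l m) / (of_int k' - of_int m) = v1"
    using assms by (auto intro!: dispersion_slope_if_freq_eq)
  then have "k \<noteq> k'" using assms(2) by auto
  then consider "k < k'" | "k' < k" by linarith
  then show ?thesis
  proof cases
    case 1
    then have "v2 < v1" using dispersion_slope_strict_mono [OF assms(1) 1 assms(3,4)] eq by simp
    then show ?thesis using 1 by (intro mult_strict_left_mono_neg) auto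
  next
    case 2
    then have "v1 < v2" using dispersion_slope_strict_mono [OF assms(1) 2 assms(4,3)] eq by simp
    then show ?thesis using 2 by (intro mult_strict_left_mono) auto
  qed
qed

text \<open>Once \<open>k^2\<close> reaches \<open>|v|\<close>, the gap estimate rules out every
  partner except \<open>-k\<close>, and that one differs in frequency by \<open>2 * k * v\<close>,
  which is nonzero.\<close>

lemma finite_resonances:
  assumes "l > 1" "v \<noteq> 0"
  shows "finite {k. \<exists>m. m \<noteq> k \<and> freq l v m = freq l v k}"
proof (rule finite_subset)
  show "{k. \<exists>m. m \<noteq> k \<and> freq l v m = freq l v k} \<subseteq> {- \<lceil>\<bar>v\<bar>\<rceil>..\<lceil>\<bar>v\<bar>\<rceil>}"
  proof
    fix k assume "k \<in> {k. \<exists>m. m \<noteq> k \<and> freq l v m = freq l v k}"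
    then obtain m where m: "m \<noteq> k" "freq l v m = freq l v k" by blast
    have "\<not> \<bar>v\<bar> \<le> (of_int k)\<^sup>2"
    proof (cases "k = - m")
      case True
      then have "of_int m * v = 0" using m by (simp add: freq_def)
      then show ?thesis using True m assms(2) by simp
    next
      case False
      show ?thesis
      proof
        assume "\<bar>v\<bar> \<le> (of_int k)\<^sup>2"
        from freq_diff_ge [OF assms(1) m(1) [symmetric] False this] m(2)
        have "(of_int m)\<^sup>2 + 1 \<le> (0::real)" by simp
        then show False using zero_le_power2 [of "of_int m :: real"] by linarith
      qed
    qed
    moreover have "\<bar>real_of_int k\<bar> \<le> (of_int k)\<^sup>2"
    proof (cases "k = 0")
      case False
      then have "1 \<le> \<bar>real_of_int k\<bar>" by (simp flip: of_int_abs)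
      then have "\<bar>real_of_int k\<bar> * 1 \<le> \<bar>real_of_int k\<bar> * \<bar>real_of_int k\<bar>"
        by (intro mult_left_mono) auto
      then show ?thesis by (simp add: power2_eq_square)
    qed simp
    ultimately have "\<bar>real_of_int k\<bar> \<le> \<bar>v\<bar>" by linarith
    then show "k \<in> {- \<lceil>\<bar>v\<bar>\<rceil>..\<lceil>\<bar>v\<bar>\<rceil>}" by (auto simp: abs_le_iff) linarith+
  qed
qed auto

lemma card_freq_class_le:
  assumes "l > 1" "finite K"
  shows "card {k\<in>K. freq l v k = w} \<le> 2"
proof (cases "{k\<in>K. freq l v k = w} = {}")
  case False
  then obtain m where m: "m \<in> K" "freq l v m = w" by blast
  have "\<exists>k. {k\<in>K. freq l v k = w} \<subseteq> {m, k}"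
  proof (cases "\<exists>k. k \<noteq> m \<and> freq l v k = w")
    case True
    then obtain k where "k \<noteq> m" "freq l v k = w" by blast
    then have "j = m \<or> j = k" if "freq l v j = w" for j
      using freq_class_unique [OF assms(1), of v j m k] m(2) that by metis
    then show ?thesis by (intro exI [of _ k]) auto
  qed auto
  then obtain k where "{k\<in>K. freq l v k = w} \<subseteq> {m, k}" by blast
  then have "card {k\<in>K. freq l v k = w} \<le> card {m, k}" by (intro card_mono) auto
  also have "\<dots> \<le> 2" by (simp add: card_insert_if)
  finally show ?thesis .
next
  case True
  then show ?thesis by (simp only: card.empty)
qed

lemma cmod_sum_sq_le:
  "(cmod (\<Sum>k\<in>S. a k))\<^sup>2 \<le> card S * (\<Sum>k\<in>S. (cmod (a k))\<^sup>2)"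
proof -
  have "(cmod (\<Sum>k\<in>S. a k))\<^sup>2 \<le> (\<Sum>k\<in>S. 1 * cmod (a k))\<^sup>2"
    by (intro power_mono) (auto intro: norm_sum)
  also have "\<dots> \<le> (\<Sum>k\<in>S. 1\<^sup>2) * (\<Sum>k\<in>S. (cmod (a k))\<^sup>2)"
    by (rule Cauchy_Schwarz_ineq_sum)
  finally show ?thesis by simp
qed

text \<open>The lower bound sees only the sum over each resonance class. The upper bound reaches the
  individual coefficients since a class has at most two members; it later yields convergence of the
  series along the line.\<close>

lemma line_ingham:
  assumes "l > 1" "T > 0"
  shows "\<exists>C>0. \<forall>K a. finite K \<longrightarrow>
     (\<Sum>w\<in>freq l v ` K. (cmod (\<Sum>k\<in>{k\<in>K. freq l v k = w}. a k))\<^sup>2) \<le> C * line_energy T l v a K \<and>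
     line_energy T l v a K \<le> C * (\<Sum>k\<in>K. (cmod (a k))\<^sup>2)"
proof -
  obtain C where C: "C > 0" "\<And>W a. finite W \<Longrightarrow> W \<subseteq> range (freq l v) \<Longrightarrow>
     (\<Sum>w\<in>W. (cmod (a w))\<^sup>2) \<le> C * energy T W a \<and> energy T W a \<le> C * (\<Sum>w\<in>W. (cmod (a w))\<^sup>2)"
    using freq_ingham [OF assms, of v] by blast
  show ?thesis
  proof (intro exI [of _ "2 * C"] conjI allI impI)
    fix K :: "int set" and a :: "int \<Rightarrow> complex" assume K: "finite K"
    define b where "b = (\<lambda>w. \<Sum>k\<in>{k\<in>K. freq l v k = w}. a k)"
    have *: "(\<Sum>w\<in>freq l v ` K. (cmod (b w))\<^sup>2) \<le> C * line_energy T l v a K"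
      "line_energy T l v a K \<le> C * (\<Sum>w\<in>freq l v ` K. (cmod (b w))\<^sup>2)"
      using C(2) [of "freq l v ` K" b] K unfolding line_energy_eq [OF K] b_def by auto
    have "C * line_energy T l v a K \<le> 2 * C * line_energy T l v a K"
      using C line_energy_nonneg [of T l v a K] by simp
    with *(1) show "(\<Sum>w\<in>freq l v ` K. (cmod (\<Sum>k\<in>{k\<in>K. freq l v k = w}. a k))\<^sup>2) \<le> 2 * C * line_energy T l v a K"
      unfolding b_def by linarith
    have "(\<Sum>w\<in>freq l v ` K. (cmod (b w))\<^sup>2) \<le>
        (\<Sum>w\<in>freq l v ` K. 2 * (\<Sum>k\<in>{k\<in>K. freq l v k = w}. (cmod (a k))\<^sup>2))"
    proof (rule sum_mono)
      fix w
      have "real (card {k\<in>K. freq l v k = w}) \<le> 2"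
        using card_freq_class_le [OF assms(1) K, of v w] by simp
      then show "(cmod (b w))\<^sup>2 \<le> 2 * (\<Sum>k\<in>{k\<in>K. freq l v k = w}. (cmod (a k))\<^sup>2)"
        unfolding b_def by (intro order_trans [OF cmod_sum_sq_le] mult_right_mono sum_nonneg) auto
    qed
    also have "\<dots> = 2 * (\<Sum>k\<in>K. (cmod (a k))\<^sup>2)"
      unfolding sum_distrib_left [symmetric] by (subst sum.image_gen [OF K, of _ "freq l v"]) simp
    finally have "C * (\<Sum>w\<in>freq l v ` K. (cmod (b w))\<^sup>2) \<le> C * (2 * (\<Sum>k\<in>K. (cmod (a k))\<^sup>2))"
      using C by (intro mult_left_mono) auto
    with *(2) show "line_energy T l v a K \<le> 2 * C * (\<Sum>k\<in>K. (cmod (a k))\<^sup>2)"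
      by simp
  qed (use C in auto)
qed

text \<open>
  A coefficient at \<open>k\<close> that resonates with \<open>m\<close> on the second line is controlled by that at \<open>m\<close>, which
  is observed on the first line alone or together with some \<open>k'\<close>. By \<open>freq_chain_monotone\<close> the step
  from \<open>k\<close> to \<open>k'\<close> always has the same direction, so the chain leaves the finite set \<open>F\<close> of resonances.
\<close>

lemma finite_observability_aux:
  assumes "l > 1" "v1 \<noteq> v2" "T > 0" "v2 \<noteq> 0"
  shows "\<exists>C>0. \<forall>K a1 a2. finite K \<longrightarrow> (\<forall>k. cmod (a1 k) = cmod (a2 k)) \<longrightarrow>
     (\<Sum>k\<in>K. (cmod (a1 k))\<^sup>2) \<le> C * (line_energy T l v1 a1 K + line_energy T l v2 a2 K)"
proof -
  \<comment> \<open>Coefficients vanish outside \<open>K\<close> so that a sum over a class within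
    \<open>K\<close> is the sum over the whole class, even if \<open>K\<close> separates a resonant
    pair. The final step restores generality by truncation.\<close>
  define adm where "adm = (\<lambda>K (a1::int \<Rightarrow> complex) (a2::int \<Rightarrow> complex).
      finite K \<and> (\<forall>k. cmod (a1 k) = cmod (a2 k)) \<and> (\<forall>k. k \<notin> K \<longrightarrow> a1 k = 0))"
  define E where "E = (\<lambda>K a1 a2. line_energy T l v1 a1 K + line_energy T l v2 a2 K)"
  \<comment> \<open>The constant may depend on \<open>k\<close> but not on \<open>K\<close> or the
    coefficients; it is summed only over the finite set \<open>F\<close>.\<close>
  define bnd where "bnd = (\<lambda>k. \<exists>D\<ge>0. \<forall>K a1 a2. adm K a1 a2 \<longrightarrow> (cmod (a1 k))\<^sup>2 \<le> D * E K a1 a2)"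
  define F where "F = {k. \<exists>m. m \<noteq> k \<and> freq l v2 m = freq l v2 k}"
  have fin: "finite F" unfolding F_def by (rule finite_resonances [OF assms(1,4)])
  have E: "E K a1 a2 \<ge> 0" for K a1 a2 unfolding E_def by (intro add_nonneg_nonneg line_energy_nonneg)
  have cls: "\<exists>C>0. \<forall>K a1 a2 a. adm K a1 a2 \<longrightarrow> a = (if v = v1 then a1 else a2) \<longrightarrow>
      (\<Sum>w\<in>freq l v ` K. (cmod (\<Sum>k\<in>{k\<in>K. freq l v k = w}. a k))\<^sup>2) \<le> C * E K a1 a2"
    if v: "v = v1 \<or> v = v2" for v
  proof -
    obtain C where C: "C > 0" "\<And>K a. finite K \<Longrightarrow>
     (\<Sum>w\<in>freq l v ` K. (cmod (\<Sum>k\<in>{k\<in>K. freq l v k = w}. a k))\<^sup>2) \<le> C * line_energy T l v a K"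
      using line_ingham [OF assms(1,3), of v] by blast
    have le: "C * line_energy T l v (if v = v1 then a1 else a2) K \<le> C * E K a1 a2" for a1 a2 K
      using v C(1) line_energy_nonneg assms(2) unfolding E_def by (intro mult_left_mono) auto
    show ?thesis
    proof (intro exI [of _ C] conjI allI impI C(1))
      fix K a1 a2 and a :: "int \<Rightarrow> complex"
      assume "adm K a1 a2" and a: "a = (if v = v1 then a1 else a2)"
      then have "finite K" by (simp add: adm_def)
      from order_trans [OF C(2) [OF this] le, of a1 a2] a
      show "(\<Sum>w\<in>freq l v ` K. (cmod (\<Sum>k\<in>{k\<in>K. freq l v k = w}. a k))\<^sup>2) \<le> C * E K a1 a2"
        by simp
    qed
  qed
  have single: "\<exists>C>0. \<forall>K a1 a2 w. adm K a1 a2 \<longrightarrow>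
      (cmod (\<Sum>k\<in>{k\<in>K. freq l v k = w}. (if v = v1 then a1 else a2) k))\<^sup>2 \<le> C * E K a1 a2"
    if "v = v1 \<or> v = v2" for v
  proof -
    obtain C where C: "C > 0" "\<And>K a1 a2 a. adm K a1 a2 \<Longrightarrow> a = (if v = v1 then a1 else a2) \<Longrightarrow>
      (\<Sum>w\<in>freq l v ` K. (cmod (\<Sum>k\<in>{k\<in>K. freq l v k = w}. a k))\<^sup>2) \<le> C * E K a1 a2"
      using cls [OF \<open>v = v1 \<or> v = v2\<close>] by blast
    have "(cmod (\<Sum>k\<in>{k\<in>K. freq l v k = w}. (if v = v1 then a1 else a2) k))\<^sup>2 \<le> C * E K a1 a2"
      if adm: "adm K a1 a2" for K a1 a2 w
    proof (cases "w \<in> freq l v ` K")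
      case True
      show ?thesis
        using adm by (intro order_trans [OF member_le_sum C(2) [OF adm refl]] True) (auto simp: adm_def)
    next
      case False
      then have empty: "{k\<in>K. freq l v k = w} = {}" by auto
      show ?thesis unfolding empty using C(1) E by simp
    qed
    with C(1) show ?thesis by blast
  qed
  have alone: "bnd k" if "v = v1 \<or> v = v2" "\<And>m. freq l v m = freq l v k \<Longrightarrow> m = k" for v k
  proof -
    obtain C where C: "C > 0" "\<And>K a1 a2 w. adm K a1 a2 \<Longrightarrow>
      (cmod (\<Sum>k\<in>{k\<in>K. freq l v k = w}. (if v = v1 then a1 else a2) k))\<^sup>2 \<le> C * E K a1 a2"
      using single [OF \<open>v = v1 \<or> v = v2\<close>] by blast
    have "(cmod (a1 k))\<^sup>2 \<le> C * E K a1 a2" if adm: "adm K a1 a2" for K a1 a2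
    proof (cases "k \<in> K")
      case True
      then have "{j\<in>K. freq l v j = freq l v k} = {k}"
        using \<open>\<And>m. freq l v m = freq l v k \<Longrightarrow> m = k\<close> by auto
      then show ?thesis using C(2) [OF adm, of "freq l v k"] adm by (auto simp: adm_def split: if_splits)
    next
      case False
      then show ?thesis using adm C(1) E by (simp add: adm_def)
    qed
    then show ?thesis unfolding bnd_def using C(1) by (intro exI [of _ C]) auto
  qed
  have partner: "bnd k" if "v = v1 \<or> v = v2" "freq l v m = freq l v k" "m \<noteq> k" "bnd m" for v k m
  proof -
    obtain C where C: "C > 0" "\<And>K a1 a2 w. adm K a1 a2 \<Longrightarrow>
      (cmod (\<Sum>k\<in>{k\<in>K. freq l v k = w}. (if v = v1 then a1 else a2) k))\<^sup>2 \<le> C * E K a1 a2"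
      using single [OF \<open>v = v1 \<or> v = v2\<close>] by blast
    obtain D where D: "D \<ge> 0" "\<And>K a1 a2. adm K a1 a2 \<Longrightarrow> (cmod (a1 m))\<^sup>2 \<le> D * E K a1 a2"
      using \<open>bnd m\<close> unfolding bnd_def by blast
    have classes: "freq l v j = freq l v k \<longleftrightarrow> j = k \<or> j = m" for j
      using freq_class_unique [OF assms(1), of v m k j] that by auto
    have "(cmod (a1 k))\<^sup>2 \<le> (2 * C + 2 * D) * E K a1 a2" if adm: "adm K a1 a2" for K a1 a2
    proof -
      define a where "a = (if v = v1 then a1 else a2)"
      have a: "cmod (a j) = cmod (a1 j)" for j using adm by (auto simp: a_def adm_def)
      have a0: "a j = 0" if "j \<notin> K" for j
        using a [of j] adm that by (simp add: adm_def)
      have "(\<Sum>j\<in>{j\<in>K. freq l v j = freq l v k}. a j) = (\<Sum>j\<in>{k, m}. a j)"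
        using a0 by (intro sum.mono_neutral_left) (auto simp: classes)
      also have "\<dots> = a k + a m" using \<open>m \<noteq> k\<close> by simp
      finally have "(cmod (a k + a m))\<^sup>2 \<le> C * E K a1 a2"
        using C(2) [OF adm, of "freq l v k"] by (simp add: a_def)
      then show ?thesis
        using cmod_diff_sq_le [of "a k + a m" "a m"] D(2) [OF adm] by (simp add: a algebra_simps)
    qed
    then show ?thesis unfolding bnd_def using C(1) D(1) by (intro exI [of _ "2 * C + 2 * D"]) auto
  qed
  have bnd: "bnd k" for k
  \<comment> \<open>The position of \<open>k\<close> in the direction of the chain, measured by
    counting the elements of the finite set \<open>F\<close> already passed. If \<open>k'\<close> is
    again in \<open>F\<close>, it is counted for \<open>k\<close> but not for itself, so the number
    drops.\<close>
  proof (induction "card {j\<in>F. (v2 - v1) * of_int j < (v2 - v1) * of_int k}" arbitrary: k rule: less_induct)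
    case less
    show ?case
    proof (cases "k \<in> F")
      case False
      then show ?thesis by (intro alone [of v2]) (auto simp: F_def)
    next
      case True
      then obtain m where m: "m \<noteq> k" "freq l v2 m = freq l v2 k" unfolding F_def by blast
      have "bnd m"
      proof (cases "\<exists>k'. k' \<noteq> m \<and> freq l v1 k' = freq l v1 m")
        case False
        then show ?thesis by (intro alone [of v1]) auto
      next
        case True
        then obtain k' where k': "k' \<noteq> m" "freq l v1 k' = freq l v1 m" by blast
        have lt: "(v2 - v1) * of_int k' < (v2 - v1) * of_int k"
          using m k' by (intro freq_chain_monotone [OF assms(1,2), of k m k']) auto
        have "bnd k'"
        proof (cases "k' \<in> F")
          case False
          then show ?thesis by (intro alone [of v2]) (auto simp: F_def)
        next
          case True
          show ?thesis
            by (rule less.hyps, rule psubset_card_mono) (use fin lt True in auto)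
        qed
        then show ?thesis using k' by (intro partner [of v1 k' m]) auto
      qed
      then show ?thesis using m by (intro partner [of v2 m k]) auto
    qed
  qed
  then obtain D where D: "\<And>k. D k \<ge> 0" "\<And>k K a1 a2. adm K a1 a2 \<Longrightarrow> (cmod (a1 k))\<^sup>2 \<le> D k * E K a1 a2"
    unfolding bnd_def by metis
  obtain C where C: "C > 0" "\<And>K a1 a2 a. adm K a1 a2 \<Longrightarrow> a = (if v2 = v1 then a1 else a2) \<Longrightarrow>
      (\<Sum>w\<in>freq l v2 ` K. (cmod (\<Sum>k\<in>{k\<in>K. freq l v2 k = w}. a k))\<^sup>2) \<le> C * E K a1 a2"
    using cls [of v2] by blast
  \<comment> \<open>Outside \<open>F\<close> all classes on the second line are singletons, so one
    Ingham inequality bounds all those coefficients together; only \<open>F\<close> uses the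
    individual constants \<open>D k\<close>.\<close>
  have total: "(\<Sum>k\<in>K. (cmod (a1 k))\<^sup>2) \<le> (C + (\<Sum>k\<in>F. D k)) * E K a1 a2" if adm: "adm K a1 a2" for K a1 a2
  proof -
    have K: "finite K" using adm by (simp add: adm_def)
    have inj: "inj_on (freq l v2) (K - F)" unfolding inj_on_def F_def by auto
    have sing: "{j\<in>K. freq l v2 j = freq l v2 k} = {k}" if "k \<in> K - F" for k
      using that unfolding F_def by auto
    have "(\<Sum>k\<in>K - F. (cmod (a1 k))\<^sup>2) =
        (\<Sum>k\<in>K - F. (cmod (\<Sum>j\<in>{j\<in>K. freq l v2 j = freq l v2 k}. a2 j))\<^sup>2)"
      using adm by (intro sum.cong refl) (simp add: sing adm_def)
    also have "\<dots> = (\<Sum>w\<in>freq l v2 ` (K - F). (cmod (\<Sum>k\<in>{k\<in>K. freq l v2 k = w}. a2 k))\<^sup>2)"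
      by (simp add: sum.reindex [OF inj])
    also have "\<dots> \<le> (\<Sum>w\<in>freq l v2 ` K. (cmod (\<Sum>k\<in>{k\<in>K. freq l v2 k = w}. a2 k))\<^sup>2)"
      using K by (intro sum_mono2) auto
    also have "\<dots> \<le> C * E K a1 a2" using C(2) [OF adm] assms(2) by simp
    finally have 1: "(\<Sum>k\<in>K - F. (cmod (a1 k))\<^sup>2) \<le> C * E K a1 a2" .
    have "(\<Sum>k\<in>K \<inter> F. (cmod (a1 k))\<^sup>2) \<le> (\<Sum>k\<in>F. D k * E K a1 a2)"
      by (rule order_trans [OF sum_mono2 [OF fin] sum_mono]) (use D(2) [OF adm] in auto)
    also have "\<dots> = (\<Sum>k\<in>F. D k) * E K a1 a2" by (simp add: sum_distrib_right)
    finally have 2: "(\<Sum>k\<in>K \<inter> F. (cmod (a1 k))\<^sup>2) \<le> (\<Sum>k\<in>F. D k) * E K a1 a2" .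
    have "(\<Sum>k\<in>K. (cmod (a1 k))\<^sup>2) = (\<Sum>k\<in>K \<inter> F. (cmod (a1 k))\<^sup>2) + (\<Sum>k\<in>K - F. (cmod (a1 k))\<^sup>2)"
      by (rule sum.Int_Diff [OF K])
    with 1 2 show ?thesis by (simp add: distrib_right)
  qed
  show ?thesis
  proof (intro exI [of _ "C + (\<Sum>k\<in>F. D k)"] conjI allI impI)
    show "C + (\<Sum>k\<in>F. D k) > 0" using C(1) D(1) by (simp add: add_pos_nonneg sum_nonneg)
    fix K :: "int set" and a1 a2 :: "int \<Rightarrow> complex"
    assume K: "finite K" and eq: "\<forall>k. cmod (a1 k) = cmod (a2 k)"
    let ?r = "\<lambda>a k. if k \<in> K then a k else 0"
    have "adm K (?r a1) (?r a2)" using K eq by (simp add: adm_def)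
    from total [OF this] show "(\<Sum>k\<in>K. (cmod (a1 k))\<^sup>2) \<le>
        (C + (\<Sum>k\<in>F. D k)) * (line_energy T l v1 a1 K + line_energy T l v2 a2 K)"
      by (simp add: E_def line_energy_def)
  qed
qed

text \<open>The chain argument wants a nonzero speed on its second line. Distinct speeds do not both
  vanish, so the lines can be interchanged if necessary.\<close>

proposition finite_observability:
  assumes "l > 1" "v1 \<noteq> v2" "T > 0"
  shows "\<exists>C>0. \<forall>K a1 a2. finite K \<longrightarrow> (\<forall>k. cmod (a1 k) = cmod (a2 k)) \<longrightarrow>
     (\<Sum>k\<in>K. (cmod (a1 k))\<^sup>2) \<le> C * (line_energy T l v1 a1 K + line_energy T l v2 a2 K)"
proof (cases "v2 = 0")
  case False
  then show ?thesis using finite_observability_aux [OF assms] by blast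
next
  case True
  then have "v1 \<noteq> 0" using assms(2) by simp
  then obtain C where C: "C > 0" "\<And>K a1 a2. finite K \<Longrightarrow> (\<forall>k. cmod (a1 k) = cmod (a2 k)) \<Longrightarrow>
     (\<Sum>k\<in>K. (cmod (a1 k))\<^sup>2) \<le> C * (line_energy T l v2 a1 K + line_energy T l v1 a2 K)"
    using finite_observability_aux [OF assms(1) assms(2) [symmetric] assms(3)] by blast
  have "(\<Sum>k\<in>K. (cmod (a1 k))\<^sup>2) \<le> C * (line_energy T l v1 a1 K + line_energy T l v2 a2 K)"
    if "finite K" "\<forall>k. cmod (a1 k) = cmod (a2 k)" for K a1 a2
    using C(2) [of K a2 a1] that by (simp add: add.commute)
  with C(1) show ?thesis by blast
qed

section \<open>Convergence in L2\<close>

text \<open>Riesz-Fischer for unconditional sums: smallness of all sums disjoint from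
  \<open>K0\<close> is the Cauchy criterion along finite subsets. An increasing sequence of finite
  sets yields an almost everywhere limit, and the tail bounds then control every larger finite
  set.\<close>

lemma L2_sum_exists:
  fixes f :: "int \<Rightarrow> real \<Rightarrow> complex"
  assumes fin: "emeasure (lebesgue_on S) (space (lebesgue_on S)) < \<infinity>"
    and f: "\<And>k. f k square_integrable_on S"
    and cauchy: "\<And>e. e > 0 \<Longrightarrow> \<exists>K0. finite K0 \<and> (\<forall>K. finite K \<longrightarrow> K \<inter> K0 = {} \<longrightarrow>
        (\<integral>x. (cmod (\<Sum>k\<in>K. f k x))\<^sup>2 \<partial>lebesgue_on S) \<le> e)"
  shows "\<exists>g. has_L2_sum f g S"
proof -
  define M where "M = lebesgue_on S"
  interpret finite_measure M using fin unfolding M_def by (intro finite_measureI less_imp_neq)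
  define s where "s = (\<lambda>K x. \<Sum>k\<in>K. f k x)"
  have s_sq: "s K square_integrable_on S" if "finite K" for K
    unfolding s_def using square_integrable_sum [OF f that] .
  have s_meas [measurable]: "s K \<in> borel_measurable M" if "finite K" for K
    using s_sq [OF that] by (simp add: square_integrable_on_def M_def)
  obtain K0 where K0: "\<And>n. finite (K0 n)" "\<And>n K. finite K \<Longrightarrow> K \<inter> K0 n = {} \<Longrightarrow>
      (\<integral>x. (cmod (s K x))\<^sup>2 \<partial>M) \<le> (1/4) ^ n"
  proof -
    have "\<forall>n::nat. \<exists>K0. finite K0 \<and> (\<forall>K. finite K \<longrightarrow> K \<inter> K0 = {} \<longrightarrow>
        (\<integral>x. (cmod (s K x))\<^sup>2 \<partial>M) \<le> (1/4) ^ n)"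
      unfolding s_def M_def by (intro allI cauchy) auto
    then show ?thesis using that by metis
  qed
  define L where "L = (\<lambda>n. \<Union>i\<le>n. K0 i)"
  have L: "finite (L n)" for n unfolding L_def using K0 by auto
  have L_mono: "L m \<subseteq> L n" if "m \<le> n" for m n using that unfolding L_def by (intro UN_mono) auto
  have K0L: "K0 n \<subseteq> L n" for n unfolding L_def by auto
  have int_sq: "integrable M (\<lambda>x. (cmod (s K x))\<^sup>2)" if "finite K" for K
    using s_sq [OF that] by (simp add: square_integrable_on_def M_def)
  have s_diff: "s A x - s B x = s (A - B) x - s (B - A) x" if "finite A" "finite B" for A B x
    unfolding s_def using that
    by (simp add: sum.Int_Diff [of A _ B] sum.Int_Diff [of B _ A] Int_commute)
  \<comment> \<open>Neither of \<open>K\<close> and \<open>L n\<close> need contain the other, but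
    both contain \<open>L m\<close>; the two one-sided differences therefore avoid
    \<open>K0 m\<close>, and each contributes \<open>2 * (1/4)^m\<close>.\<close>
  have close: "(\<integral>x. (cmod (s K x - s (L n) x))\<^sup>2 \<partial>M) \<le> 4 * (1/4) ^ m"
    "integrable M (\<lambda>x. (cmod (s K x - s (L n) x))\<^sup>2)"
    if K: "finite K" "L m \<subseteq> K" "m \<le> n" for K m n
  proof -
    show int: "integrable M (\<lambda>x. (cmod (s K x - s (L n) x))\<^sup>2)"
      using square_integrable_diff [OF s_sq s_sq, of K "L n"] K L by (simp add: square_integrable_on_def M_def)
    have "(\<integral>x. (cmod (s K x - s (L n) x))\<^sup>2 \<partial>M) \<le>
        (\<integral>x. 2 * (cmod (s (K - L n) x))\<^sup>2 + 2 * (cmod (s (L n - K) x))\<^sup>2 \<partial>M)"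
    proof (rule integral_mono [OF int])
      show "integrable M (\<lambda>x. 2 * (cmod (s (K - L n) x))\<^sup>2 + 2 * (cmod (s (L n - K) x))\<^sup>2)"
        using K L by (intro Bochner_Integration.integrable_add integrable_mult_right int_sq) auto
      show "(cmod (s K x - s (L n) x))\<^sup>2 \<le>
          2 * (cmod (s (K - L n) x))\<^sup>2 + 2 * (cmod (s (L n - K) x))\<^sup>2" for x
        unfolding s_diff [OF K(1) L] by (rule cmod_diff_sq_le)
    qed
    also have "\<dots> = 2 * (\<integral>x. (cmod (s (K - L n) x))\<^sup>2 \<partial>M) + 2 * (\<integral>x. (cmod (s (L n - K) x))\<^sup>2 \<partial>M)"
      using K L by (simp add: int_sq)
    also have "\<dots> \<le> 2 * (1/4) ^ m + 2 * (1/4) ^ m"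
      using K L K0L [of m] L_mono [OF K(3)] by (intro add_mono mult_left_mono K0) auto
    finally show "(\<integral>x. (cmod (s K x - s (L n) x))\<^sup>2 \<partial>M) \<le> 4 * (1/4) ^ m" by simp
  qed
  define d where "d = (\<lambda>n x. cmod (s (L (Suc n)) x - s (L n) x))"
  have d_meas [measurable]: "d n \<in> borel_measurable M" for n
    unfolding d_def using L by measurable
  have d_int: "(\<integral>\<^sup>+x. ennreal (d n x) \<partial>M) \<le> ennreal ((2 + measure M (space M) / 2) * (1/2) ^ n)" for n
  proof -
    \<comment> \<open>The arithmetic-geometric inequality weighted by \<open>2^n\<close>: it
      balances the decay \<open>4^-n\<close> of the squared norms against the finite measure, so the
      integrals of \<open>d n\<close> decay like \<open>2^-n\<close> and are summable.\<close>
    have le: "d n x \<le> 2 ^ n / 2 * (d n x)\<^sup>2 + (1/2) ^ n / 2" for x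
    proof -
      have "0 \<le> (2 ^ n * d n x - 1)\<^sup>2" by simp
      then have "2 * 2 ^ n * d n x \<le> (2 ^ n)\<^sup>2 * (d n x)\<^sup>2 + 1"
        by (simp add: power2_diff power_mult_distrib)
      then show ?thesis by (simp add: field_simps power2_eq_square)
    qed
    have int: "integrable M (\<lambda>x. (d n x)\<^sup>2)" "(\<integral>x. (d n x)\<^sup>2 \<partial>M) \<le> 4 * (1/4) ^ n"
      using close [OF L, of n "Suc n" n] L_mono [of n "Suc n"] by (auto simp: d_def)
    have "(\<integral>\<^sup>+x. ennreal (d n x) \<partial>M) \<le> (\<integral>\<^sup>+x. ennreal (2 ^ n / 2 * (d n x)\<^sup>2 + (1/2) ^ n / 2) \<partial>M)"
      by (intro nn_integral_mono ennreal_leI le)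
    also have "\<dots> = ennreal (\<integral>x. 2 ^ n / 2 * (d n x)\<^sup>2 + (1/2) ^ n / 2 \<partial>M)"
      using int by (intro nn_integral_eq_integral) auto
    also have "(\<integral>x. 2 ^ n / 2 * (d n x)\<^sup>2 + (1/2) ^ n / 2 \<partial>M) =
        2 ^ n / 2 * (\<integral>x. (d n x)\<^sup>2 \<partial>M) + (1/2) ^ n / 2 * measure M (space M)"
      using int by simp
    also have "\<dots> \<le> 2 ^ n / 2 * (4 * (1/4) ^ n) + (1/2) ^ n / 2 * measure M (space M)"
      using int by (intro add_mono mult_left_mono) auto
    also have "\<dots> = (2 + measure M (space M) / 2) * (1/2) ^ n"
    proof -
      have "(2::real) ^ n * (1/4) ^ n = (1/2) ^ n" by (simp add: power_mult_distrib [symmetric])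
      then show ?thesis by (simp add: algebra_simps)
    qed
    finally show ?thesis by (auto intro: ennreal_leI)
  qed
  have "(\<integral>\<^sup>+x. (\<Sum>n. ennreal (d n x)) \<partial>M) = (\<Sum>n. \<integral>\<^sup>+x. ennreal (d n x) \<partial>M)"
    by (intro nn_integral_suminf) measurable
  also have "\<dots> \<le> (\<Sum>n. ennreal ((2 + measure M (space M) / 2) * (1/2) ^ n))"
    by (intro suminf_le d_int) auto
  also have "\<dots> < \<infinity>"
    by (subst suminf_ennreal2) (auto intro!: summable_mult summable_geometric)
  finally have fin_sum: "(\<integral>\<^sup>+x. (\<Sum>n. ennreal (d n x)) \<partial>M) < \<infinity>" .
  have "AE x in M. (\<Sum>n. ennreal (d n x)) \<noteq> \<infinity>"
    by (rule nn_integral_PInf_AE [OF _ less_imp_neq [OF fin_sum]]) measurable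
  then have AE_lim: "AE x in M. convergent (\<lambda>n. s (L n) x)"
  proof eventually_elim
    case (elim x)
    then have "summable (\<lambda>n. d n x)"
      by (intro summable_suminf_not_top) (auto simp: d_def)
    then have "summable (\<lambda>n. s (L (Suc n)) x - s (L n) x)"
      unfolding d_def by (rule summable_norm_cancel)
    then have "convergent (\<lambda>n. \<Sum>i<n. s (L (Suc i)) x - s (L i) x)"
      by (simp add: summable_iff_convergent)
    then have "convergent (\<lambda>n. s (L n) x - s (L 0) x)"
      by (simp only: sum_lessThan_telescope [of "\<lambda>n. s (L n) x"])
    then have "convergent (\<lambda>n. (s (L n) x - s (L 0) x) + s (L 0) x)"
      by (intro convergent_add convergent_const)
    then show ?case by simp
  qed
  define g where "g = (\<lambda>x. lim (\<lambda>n. s (L n) x))"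
  have g_meas [measurable]: "g \<in> borel_measurable M"
    unfolding g_def using L by (intro borel_measurable_lim_metric s_meas)
  \<comment> \<open>The bound on the distance from \<open>s K\<close> to \<open>s (L n)\<close> is
    uniform in \<open>n \<ge> m\<close>, so Fatou's lemma passes it to the limit
    \<open>g\<close>.\<close>
  have fatou: "(\<integral>\<^sup>+x. ennreal ((cmod (s K x - g x))\<^sup>2) \<partial>M) \<le> ennreal (4 * (1/4) ^ m)"
    if K: "finite K" "L m \<subseteq> K" for K m
  proof -
    have "AE x in M. ennreal ((cmod (s K x - g x))\<^sup>2) = liminf (\<lambda>n. ennreal ((cmod (s K x - s (L n) x))\<^sup>2))"
      using AE_lim
    proof eventually_elim
      case (elim x)
      then have "(\<lambda>n. s (L n) x) \<longlonglongrightarrow> g x" by (simp add: g_def convergent_LIMSEQ_iff)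
      then have "(\<lambda>n. ennreal ((cmod (s K x - s (L n) x))\<^sup>2)) \<longlonglongrightarrow> ennreal ((cmod (s K x - g x))\<^sup>2)"
        by (intro tendsto_ennrealI tendsto_intros)
      then show ?case by (intro lim_imp_Liminf [symmetric]) auto
    qed
    then have "(\<integral>\<^sup>+x. ennreal ((cmod (s K x - g x))\<^sup>2) \<partial>M) =
        (\<integral>\<^sup>+x. liminf (\<lambda>n. ennreal ((cmod (s K x - s (L n) x))\<^sup>2)) \<partial>M)"
      by (rule nn_integral_cong_AE)
    also have "\<dots> \<le> liminf (\<lambda>n. \<integral>\<^sup>+x. ennreal ((cmod (s K x - s (L n) x))\<^sup>2) \<partial>M)"
      using K L by (intro nn_integral_liminf) measurable
    also have "\<dots> \<le> liminf (\<lambda>n. ennreal (4 * (1/4) ^ m))"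
    proof (intro Liminf_mono eventually_sequentiallyI)
      fix n assume "m \<le> n"
      with close [OF K this]
      show "(\<integral>\<^sup>+x. ennreal ((cmod (s K x - s (L n) x))\<^sup>2) \<partial>M) \<le> ennreal (4 * (1/4) ^ m)"
        by (subst nn_integral_eq_integral) (auto intro: ennreal_leI)
    qed
    also have "\<dots> = ennreal (4 * (1/4) ^ m)" by (simp add: Liminf_const)
    finally show ?thesis .
  qed
  have diff_int: "integrable M (\<lambda>x. (cmod (s K x - g x))\<^sup>2)"
    "(\<integral>x. (cmod (s K x - g x))\<^sup>2 \<partial>M) \<le> 4 * (1/4) ^ m"
    if K: "finite K" "L m \<subseteq> K" for K m
  proof -
    have [measurable]: "s K \<in> borel_measurable M" using K by simp
    show int: "integrable M (\<lambda>x. (cmod (s K x - g x))\<^sup>2)"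
    proof (rule integrableI_bounded)
      show "(\<integral>\<^sup>+x. ennreal (norm ((cmod (s K x - g x))\<^sup>2)) \<partial>M) < \<infinity>"
        using le_less_trans [OF fatou [OF K] ennreal_less_top] by simp
    qed measurable
    then have "ennreal (\<integral>x. (cmod (s K x - g x))\<^sup>2 \<partial>M) \<le> ennreal (4 * (1/4) ^ m)"
      using fatou [OF K] by (subst (asm) nn_integral_eq_integral) auto
    then show "(\<integral>x. (cmod (s K x - g x))\<^sup>2 \<partial>M) \<le> 4 * (1/4) ^ m"
      by (subst (asm) ennreal_le_iff) auto
  qed
  have "(\<lambda>x. s (L 0) x - g x) square_integrable_on S"
    using diff_int(1) [OF L order_refl, of 0] s_meas [OF L, of 0] g_meas
    unfolding square_integrable_on_def M_def [symmetric] by simp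
  from square_integrable_diff [OF s_sq [OF L [of 0]] this]
  have g_sq: "g square_integrable_on S" by simp
  have "((\<lambda>K. \<integral>x. (cmod (s K x - g x))\<^sup>2 \<partial>M) \<longlongrightarrow> 0) (finite_subsets_at_top UNIV)"
  proof (rule tendstoI)
    fix e :: real assume "e > 0"
    then obtain m where "(1/4 :: real) ^ m < e / 4" using real_arch_pow_inv [of "e / 4" "1/4"] by auto
    then have m: "4 * (1/4) ^ m < e" by simp
    have "\<forall>\<^sub>F K in finite_subsets_at_top UNIV. finite K \<and> L m \<subseteq> K"
      unfolding eventually_finite_subsets_at_top using L by blast
    then show "\<forall>\<^sub>F K in finite_subsets_at_top UNIV. dist (\<integral>x. (cmod (s K x - g x))\<^sup>2 \<partial>M) 0 < e"
    proof eventually_elim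
      case (elim K)
      have "0 \<le> (\<integral>x. (cmod (s K x - g x))\<^sup>2 \<partial>M)" by (intro integral_nonneg_AE) auto
      then show ?case using diff_int(2) [of K m] elim m by (simp add: dist_real_def)
    qed
  qed
  then have "has_L2_sum f g S"
    using f g_sq by (simp add: has_L2_sum_def s_def M_def)
  then show ?thesis by blast
qed

section \<open>Completeness of the trigonometric system\<close>

definition trig_poly :: "(real \<Rightarrow> complex) \<Rightarrow> bool" where
  "trig_poly q \<longleftrightarrow> (\<exists>K b. finite K \<and> q = (\<lambda>x. \<Sum>k\<in>K. b k * fourier_mode k x))"

lemma fourier_mode_eq_cis: "fourier_mode k x = cis (of_int k * x)"
  by (simp add: fourier_mode_def cis_conv_exp mult.assoc)

lemma continuous_on_fourier_mode [continuous_intros]: "continuous_on S (fourier_mode k)"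
  unfolding fourier_mode_eq_cis [abs_def] by (intro continuous_intros)

text \<open>The map \<open>\<kappa>\<close> may repeat frequencies; collecting equal ones here makes
  closure under sums and products immediate.\<close>

lemma trig_polyI:
  assumes "finite I"
  shows "trig_poly (\<lambda>x. \<Sum>i\<in>I. \<beta> i * fourier_mode (\<kappa> i) x)"
  unfolding trig_poly_def
proof (intro exI conjI ext)
  show "finite (\<kappa> ` I)" using assms by simp
  show "(\<Sum>i\<in>I. \<beta> i * fourier_mode (\<kappa> i) x) =
      (\<Sum>k\<in>\<kappa> ` I. (\<Sum>i\<in>{i\<in>I. \<kappa> i = k}. \<beta> i) * fourier_mode k x)" for x
    by (subst sum.image_gen [OF assms, of _ \<kappa>]) (auto simp: sum_distrib_right intro!: sum.cong)
qed

lemma trig_poly_const: "trig_poly (\<lambda>x. c)"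
  using trig_polyI [of "{()}" "\<lambda>_. c" "\<lambda>_. 0"] by (simp add: fourier_mode_def)

lemma trig_poly_add:
  assumes "trig_poly p" "trig_poly q"
  shows "trig_poly (\<lambda>x. p x + q x)"
proof -
  obtain K b L d where "finite K" "p = (\<lambda>x. \<Sum>k\<in>K. b k * fourier_mode k x)"
    "finite L" "q = (\<lambda>x. \<Sum>k\<in>L. d k * fourier_mode k x)"
    using assms by (auto simp: trig_poly_def)
  then show ?thesis
    using trig_polyI [of "K <+> L" "case_sum b d" "case_sum id id"] by (simp add: sum.Plus)
qed

lemma trig_poly_mult:
  assumes "trig_poly p" "trig_poly q"
  shows "trig_poly (\<lambda>x. p x * q x)"
proof -
  obtain K b L d where *: "finite K" "p = (\<lambda>x. \<Sum>k\<in>K. b k * fourier_mode k x)"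
    "finite L" "q = (\<lambda>x. \<Sum>k\<in>L. d k * fourier_mode k x)"
    using assms by (auto simp: trig_poly_def)
  have "p x * q x = (\<Sum>i\<in>K \<times> L. (b (fst i) * d (snd i)) * fourier_mode (fst i + snd i) x)" for x
    unfolding * sum_product sum.cartesian_product
    by (intro sum.cong refl) (auto simp: fourier_mode_eq_cis distrib_right algebra_simps simp flip: cis_mult)
  then show ?thesis
    using trig_polyI [of "K \<times> L" "\<lambda>i. b (fst i) * d (snd i)" "\<lambda>i. fst i + snd i"] * by simp
qed

lemma trig_poly_real_polynomial:
  assumes "real_polynomial_function f"
  shows "trig_poly (\<lambda>x. of_real (f (cis x)))"
  using assms
proof induction
  case (linear f)
  interpret bounded_linear f by fact
  \<comment> \<open>A real linear functional gives \<open>cos x * f 1 + sin x * f \<i>\<close> on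
    the circle; Euler's formulas turn this into the modes 1 and -1.\<close>
  have "of_real (f (cis x)) =
      (\<Sum>k\<in>{1, -1::int}. (of_real (f 1) - of_int k * \<i> * of_real (f \<i>)) / 2 * fourier_mode k x)" for x
  proof -
    have "cis x = cos x *\<^sub>R 1 + sin x *\<^sub>R \<i>" by (simp add: complex_eq_iff)
    then have "f (cis x) = cos x * f 1 + sin x * f \<i>" by (simp add: add scaleR)
    then show ?thesis
      by (simp add: fourier_mode_eq_cis complex_eq_iff field_simps)
  qed
  then show ?case
    using trig_polyI [of "{1, -1::int}" "\<lambda>k. (of_real (f 1) - of_int k * \<i> * of_real (f \<i>)) / 2" id]
    by simp
qed (auto intro: trig_poly_const trig_poly_add trig_poly_mult)

lemma trig_poly_polynomial:
  fixes p :: "complex \<Rightarrow> complex"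
  assumes "polynomial_function p"
  shows "trig_poly (\<lambda>x. p (cis x))"
proof -
  have "real_polynomial_function (Re \<circ> p)" "real_polynomial_function (Im \<circ> p)"
    using assms bounded_linear_Re bounded_linear_Im by (auto simp: polynomial_function_def)
  then have "trig_poly (\<lambda>x. of_real ((Re \<circ> p) (cis x)) + \<i> * of_real ((Im \<circ> p) (cis x)))"
    by (intro trig_poly_add trig_poly_mult trig_poly_const trig_poly_real_polynomial)
  then show ?thesis by (simp add: complex_eq [symmetric])
qed

text \<open>Equal end values make \<open>g\<close> a continuous function on the unit circle, where
  Stone-Weierstrass provides polynomials in the real and imaginary parts; restricted to
  \<open>cis x\<close> these are trigonometric.\<close>

lemma trig_poly_approx_continuous:
  assumes "continuous_on {0..2 * pi} g" "g 0 = g (2 * pi)" "e > 0"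
  shows "\<exists>q. trig_poly q \<and> (\<forall>x\<in>{0..2 * pi}. cmod (g x - q x) < e)"
proof -
  define p where "p = (\<lambda>t. g (2 * pi * t))"
  have "continuous_on {0..1} p"
    unfolding p_def
    by (rule continuous_on_compose2 [OF assms(1)]) (auto intro!: continuous_intros simp: mult_le_cancel_left1)
  \<comment> \<open>Passing from loops to circle maps, with the trivial homotopy of \<open>p\<close>
    to itself, gives continuity also at the point 1, where \<open>Arg2pi\<close> jumps.\<close>
  then have "homotopic_loops UNIV p p"
    using assms(2) by (simp add: homotopic_loops_refl path_def pathfinish_def pathstart_def p_def)
  from homotopic_with_imp_continuous [OF homotopic_loops_imp_homotopic_circlemaps [OF this]]
  have "continuous_on (sphere 0 1) (p \<circ> (\<lambda>z. Arg2pi z / (2 * pi)))" by blast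
  from Stone_Weierstrass_polynomial_function [OF compact_sphere this assms(3)]
  obtain P where P: "polynomial_function P"
    "\<And>z. z \<in> sphere 0 1 \<Longrightarrow> cmod ((p \<circ> (\<lambda>z. Arg2pi z / (2 * pi))) z - P z) < e" by blast
  have "cmod (g x - P (cis x)) < e" if x: "x \<in> {0..2 * pi}" for x
  proof -
    have "g (Arg2pi (cis x)) = g x"
    proof (cases "x = 2 * pi")
      case True
      then show ?thesis using assms(2) Arg2pi_of_real [of 1] by (simp add: cis_2pi)
    next
      case False
      then have "Arg2pi (cis x) = x"
        using x by (intro Arg2pi_unique [of 1]) (auto simp: cis_conv_exp)
      then show ?thesis by simp
    qed
    with P(2) [of "cis x"] show ?thesis by (simp add: p_def)
  qed
  with trig_poly_polynomial [OF P(1)] show ?thesis by (intro exI [of _ "\<lambda>x. P (cis x)"]) auto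
qed

section \<open>Density of trigonometric polynomials in L2\<close>

abbreviation (input) circle :: "real measure" where
  "circle \<equiv> lebesgue_on {0..2 * pi}"

lemma continuous_square_integrable:
  assumes "continuous_on {a..b} f"
  shows "f square_integrable_on {a..b}"
  unfolding square_integrable_on_def using assms
  by (auto intro!: continuous_imp_measurable_on_sets_lebesgue continuous_imp_integrable_real continuous_intros)

lemma continuous_on_trig_poly: "trig_poly q \<Longrightarrow> continuous_on S q"
  unfolding trig_poly_def by (auto intro!: continuous_intros)

definition trig_approximable :: "(real \<Rightarrow> complex) \<Rightarrow> bool" where
  "trig_approximable f \<longleftrightarrow> (\<forall>e>0. \<exists>q. trig_poly q \<and> (\<integral>x. (cmod (f x - q x))\<^sup>2 \<partial>circle) \<le> e)"

lemma integral_L2_triangle: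
  assumes "f square_integrable_on S" "g square_integrable_on S" "h square_integrable_on S"
  shows "(\<integral>x. (cmod (f x - h x))\<^sup>2 \<partial>lebesgue_on S) \<le>
    2 * (\<integral>x. (cmod (f x - g x))\<^sup>2 \<partial>lebesgue_on S) + 2 * (\<integral>x. (cmod (g x - h x))\<^sup>2 \<partial>lebesgue_on S)"
proof -
  have i: "integrable (lebesgue_on S) (\<lambda>x. (cmod (f x - h x))\<^sup>2)"
    "integrable (lebesgue_on S) (\<lambda>x. (cmod (f x - g x))\<^sup>2)"
    "integrable (lebesgue_on S) (\<lambda>x. (cmod (g x - h x))\<^sup>2)"
    using assms square_integrable_diff unfolding square_integrable_on_def by blast+
  have "(\<integral>x. (cmod (f x - h x))\<^sup>2 \<partial>lebesgue_on S) \<le>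
      (\<integral>x. 2 * (cmod (f x - g x))\<^sup>2 + 2 * (cmod (g x - h x))\<^sup>2 \<partial>lebesgue_on S)"
  proof (rule integral_mono [OF i(1)])
    show "(cmod (f x - h x))\<^sup>2 \<le> 2 * (cmod (f x - g x))\<^sup>2 + 2 * (cmod (g x - h x))\<^sup>2" for x
      using cmod_add_sq_le [of "f x - g x" "g x - h x"] by simp
  qed (use i in auto)
  then show ?thesis using i by simp
qed

text \<open>Dominated convergence followed by the triangle inequality, whose factor 2 explains the
  two errors \<open>e / 4\<close>. It is applied twice: from continuous to bounded functions, and
  from bounded to square integrable ones.\<close>

lemma trig_approximable_limit:
  assumes f: "f square_integrable_on {0..2 * pi}"
    and s: "\<And>n::nat. s n square_integrable_on {0..2 * pi}" "\<And>n. trig_approximable (s n)"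
    and lim: "AE x in circle. (\<lambda>n. s n x) \<longlonglongrightarrow> f x"
    and w: "integrable circle w" "\<And>n x. (cmod (f x - s n x))\<^sup>2 \<le> w x"
  shows "trig_approximable f"
  unfolding trig_approximable_def
proof (intro allI impI)
  fix e :: real assume e: "e > 0"
  have m: "(\<lambda>x. (cmod (f x - s n x))\<^sup>2) \<in> borel_measurable circle" for n
    using square_integrable_diff [OF f s(1)] by (auto simp: square_integrable_on_def)
  have "(\<lambda>n. \<integral>x. (cmod (f x - s n x))\<^sup>2 \<partial>circle) \<longlonglongrightarrow> (\<integral>x. 0 \<partial>circle)"
  proof (rule integral_dominated_convergence [OF _ m w(1)])
    show "AE x in circle. (\<lambda>n. (cmod (f x - s n x))\<^sup>2) \<longlonglongrightarrow> 0"
      using lim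
    proof eventually_elim
      case (elim x)
      from tendsto_power [OF tendsto_norm [OF tendsto_diff [OF tendsto_const [of "f x"] elim]], of 2]
      show ?case by simp
    qed
  qed (use w in auto)
  then have "\<forall>\<^sub>F n in sequentially. (\<integral>x. (cmod (f x - s n x))\<^sup>2 \<partial>circle) < e / 4"
    using e by (intro order_tendstoD) auto
  then obtain n where n: "(\<integral>x. (cmod (f x - s n x))\<^sup>2 \<partial>circle) < e / 4"
    using eventually_happens' [OF sequentially_bot] by blast
  obtain q where q: "trig_poly q" "(\<integral>x. (cmod (s n x - q x))\<^sup>2 \<partial>circle) \<le> e / 4"
    using s(2) [of n] e unfolding trig_approximable_def by (meson divide_pos_pos zero_less_numeral)
  have "(\<integral>x. (cmod (f x - q x))\<^sup>2 \<partial>circle) \<le> e"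
    using integral_L2_triangle [OF f s(1) [of n] continuous_square_integrable [OF continuous_on_trig_poly [OF q(1)]]] n q(2)
    by linarith
  with q(1) show "\<exists>q. trig_poly q \<and> (\<integral>x. (cmod (f x - q x))\<^sup>2 \<partial>circle) \<le> e" by blast
qed

lemma trig_approximable_continuous:
  assumes "continuous_on {0..2 * pi} g" "g 0 = g (2 * pi)"
  shows "trig_approximable g"
  unfolding trig_approximable_def
proof (intro allI impI)
  fix e :: real assume e: "e > 0"
  define d where "d = sqrt (e / (2 * pi))"
  have d: "d > 0" "d\<^sup>2 * (2 * pi) = e" using e by (auto simp: d_def)
  obtain q where q: "trig_poly q" "\<And>x. x \<in> {0..2 * pi} \<Longrightarrow> cmod (g x - q x) < d"
    using trig_poly_approx_continuous [OF assms d(1)] by blast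
  have "(\<integral>x. (cmod (g x - q x))\<^sup>2 \<partial>circle) \<le> (\<integral>x. d\<^sup>2 \<partial>circle)"
  proof (rule integral_mono)
    show "integrable circle (\<lambda>x. (cmod (g x - q x))\<^sup>2)"
      by (intro continuous_imp_integrable_real continuous_intros assms continuous_on_trig_poly q)
    show "integrable circle (\<lambda>x. d\<^sup>2)"
      by (intro continuous_imp_integrable_real continuous_intros)
    show "(cmod (g x - q x))\<^sup>2 \<le> d\<^sup>2" if "x \<in> space circle" for x
      using that q(2) [of x] by (intro power_mono) auto
  qed
  also have "\<dots> = e" using d(2) by (simp add: measure_restrict_space mult.commute)
  finally show "\<exists>q. trig_poly q \<and> (\<integral>x. (cmod (g x - q x))\<^sup>2 \<partial>circle) \<le> e"
    using q(1) by blast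
qed

text \<open>The radial retraction onto the closed disc of radius \<open>M\<close>, written without
  cases so that continuity is immediate.\<close>

definition clamp_norm :: "real \<Rightarrow> complex \<Rightarrow> complex" where
  "clamp_norm M z = (M / max M (cmod z)) *\<^sub>R z"

lemma continuous_on_clamp_norm:
  "M > 0 \<Longrightarrow> continuous_on S f \<Longrightarrow> continuous_on S (\<lambda>x. clamp_norm M (f x))"
  unfolding clamp_norm_def by (intro continuous_intros) (auto simp: max_def)

lemma norm_clamp_norm_le: "M > 0 \<Longrightarrow> cmod (clamp_norm M z) \<le> M"
  by (auto simp: clamp_norm_def max_def)

lemma norm_diff_clamp_norm_le: "M > 0 \<Longrightarrow> cmod (z - clamp_norm M z) \<le> cmod z"
proof -
  assume M: "M > 0"
  define r where "r = M / max M (cmod z)"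
  have "0 \<le> r" "r \<le> 1" using M by (auto simp: r_def max_def divide_le_eq)
  moreover have "z - clamp_norm M z = (1 - r) *\<^sub>R z" by (simp add: clamp_norm_def r_def scaleR_left_diff_distrib)
  ultimately show ?thesis by (simp add: mult_left_le_one_le)
qed

lemma clamp_norm_ident: "M > 0 \<Longrightarrow> cmod z \<le> M \<Longrightarrow> clamp_norm M z = z"
  by (simp add: clamp_norm_def max_def)

text \<open>A measurable function is an almost everywhere limit of continuous ones. These need two
  repairs: clamping makes them uniformly bounded, hence dominated, and a cutoff makes them
  periodic.\<close>

lemma trig_approximable_bounded:
  assumes f: "f \<in> borel_measurable circle" and M: "M > 0" "\<And>x. cmod (f x) \<le> M"
  shows "trig_approximable f"
proof -
  have "f measurable_on {0..2 * pi}" using f by (simp add: measurable_on_iff_borel_measurable)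
  then obtain N g where N: "negligible N" and g: "\<And>n. continuous_on UNIV (g n)"
    and lim: "\<And>x. x \<notin> N \<Longrightarrow> (\<lambda>n. g n x) \<longlonglongrightarrow> (if x \<in> {0..2 * pi} then f x else 0)"
    unfolding measurable_on_def by metis
  \<comment> \<open>A trapezoid vanishing at both end points, so that \<open>s n\<close> takes equal
    values there; at each interior point it is eventually 1.\<close>
  define cut where "cut = (\<lambda>n x. max 0 (min 1 (min (real n * x) (real n * (2 * pi - x)))))"
  define s where "s = (\<lambda>n x. cut n x *\<^sub>R clamp_norm M (g n x))"
  have s_cont: "continuous_on {0..2 * pi} (s n)" for n
    unfolding s_def cut_def
    by (intro continuous_intros continuous_on_clamp_norm M(1) continuous_on_subset [OF g]) auto
  have s_le: "cmod (s n x) \<le> M" for n x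
  proof -
    have "\<bar>cut n x\<bar> * cmod (clamp_norm M (g n x)) \<le> 1 * M"
      using M norm_clamp_norm_le by (intro mult_mono) (auto simp: cut_def)
    then show ?thesis by (simp add: s_def)
  qed
  have sq: "(\<lambda>x. (cmod (f x))\<^sup>2) \<in> borel_measurable circle" using f by measurable
  have const: "integrable circle (\<lambda>x. c :: real)" for c
    by (intro continuous_imp_integrable_real continuous_intros)
  show ?thesis
  proof (rule trig_approximable_limit [where s = s and w = "\<lambda>x. (2 * M)\<^sup>2"])
    have "integrable circle (\<lambda>x. (cmod (f x))\<^sup>2)"
      using sq M by (intro Bochner_Integration.integrable_bound [OF const [of "M\<^sup>2"]])
        (auto intro!: power_mono)
    with f show "f square_integrable_on {0..2 * pi}" by (simp add: square_integrable_on_def)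
    show "s n square_integrable_on {0..2 * pi}" for n
      by (rule continuous_square_integrable [OF s_cont])
    show "trig_approximable (s n)" for n
      by (rule trig_approximable_continuous [OF s_cont]) (simp add: s_def cut_def)
    show "(cmod (f x - s n x))\<^sup>2 \<le> (2 * M)\<^sup>2" for n x
      using norm_triangle_ineq4 [of "f x" "s n x"] M(2) [of x] s_le [of n x]
      by (intro power_mono) auto
    have "N \<union> {0, 2 * pi} \<in> null_sets lebesgue"
      using N by (simp add: negligible_iff_null_sets [symmetric] negligible_Un_eq)
    moreover have "(\<lambda>n. s n x) \<longlonglongrightarrow> f x" if "x \<in> {0..2 * pi}" "x \<notin> N \<union> {0, 2 * pi}" for x
    proof -
      have x: "0 < x" "x < 2 * pi" "x \<notin> N" using that by auto
      have "(\<lambda>n. clamp_norm M (g n x)) \<longlonglongrightarrow> clamp_norm M (f x)"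
      proof (rule continuous_on_tendsto_compose [of UNIV "clamp_norm M"])
        show "continuous_on UNIV (clamp_norm M)"
          using continuous_on_clamp_norm [OF M(1), of UNIV "\<lambda>x. x"] by (simp add: continuous_on_id)
        show "(\<lambda>n. g n x) \<longlonglongrightarrow> f x" using lim [of x] x by simp
      qed auto
      then have *: "(\<lambda>n. clamp_norm M (g n x)) \<longlonglongrightarrow> f x"
        using M by (simp add: clamp_norm_ident)
      obtain n0 where n0: "real n0 > max (1 / x) (1 / (2 * pi - x))" using reals_Archimedean2 by blast
      have "cut n x = 1" if "n \<ge> n0" for n
      proof -
        have "1 / x \<le> n" "1 / (2 * pi - x) \<le> n" using n0 that by auto
        then have "1 \<le> n * x" "1 \<le> n * (2 * pi - x)" using x by (simp_all add: field_simps)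
        then show ?thesis by (simp add: cut_def)
      qed
      then have "(\<lambda>n. cut n x) \<longlonglongrightarrow> 1"
        by (intro tendsto_eventually) (auto simp: eventually_sequentially)
      from tendsto_scaleR [OF this *] show ?thesis by (simp add: s_def)
    qed
    ultimately have "AE x in lebesgue. x \<in> {0..2 * pi} \<longrightarrow> (\<lambda>n. s n x) \<longlonglongrightarrow> f x"
      by (intro AE_I' [of "N \<union> {0, 2 * pi}"]) auto
    then show "AE x in circle. (\<lambda>n. s n x) \<longlonglongrightarrow> f x"
      by (simp add: AE_restrict_space_iff)
  qed (rule const)
qed

text \<open>Truncation at growing heights is eventually exact at each point, and its error is
  dominated by \<open>f\<close> itself. The heights \<open>Suc n\<close> keep the clamping radius
  positive.\<close>

lemma trig_approximable_L2:
  assumes f: "f square_integrable_on {0..2 * pi}"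
  shows "trig_approximable f"
proof (rule trig_approximable_limit [OF f, where s = "\<lambda>n x. clamp_norm (real (Suc n)) (f x)"
      and w = "\<lambda>x. (cmod (f x))\<^sup>2"])
  have fm: "f \<in> borel_measurable circle" using f by (simp add: square_integrable_on_def)
  have m: "(\<lambda>x. clamp_norm (real (Suc n)) (f x)) \<in> borel_measurable circle" for n
    unfolding clamp_norm_def using fm by measurable
  show app: "trig_approximable (\<lambda>x. clamp_norm (real (Suc n)) (f x))" for n
    by (rule trig_approximable_bounded [OF m, of "real (Suc n)"]) (auto intro: norm_clamp_norm_le simp del: of_nat_Suc)
  show "integrable circle (\<lambda>x. (cmod (f x))\<^sup>2)" using f by (simp add: square_integrable_on_def)
  have const: "integrable circle (\<lambda>x. c :: real)" for c
    by (intro continuous_imp_integrable_real continuous_intros)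
  show "(\<lambda>x. clamp_norm (real (Suc n)) (f x)) square_integrable_on {0..2 * pi}" for n
    unfolding square_integrable_on_def
  proof
    show "integrable circle (\<lambda>x. (cmod (clamp_norm (real (Suc n)) (f x)))\<^sup>2)"
      using m [of n] norm_clamp_norm_le [of "real (Suc n)"]
      by (intro Bochner_Integration.integrable_bound [OF const [of "(real (Suc n))\<^sup>2"]])
         (auto intro!: power_mono simp del: of_nat_Suc)
  qed (rule m)
  show "AE x in circle. (\<lambda>n. clamp_norm (real (Suc n)) (f x)) \<longlonglongrightarrow> f x"
  proof (rule AE_I2)
    fix x
    obtain n0 where n0: "real n0 > cmod (f x)" using reals_Archimedean2 by blast
    have "clamp_norm (real (Suc n)) (f x) = f x" if "n \<ge> n0" for n
      using n0 that by (intro clamp_norm_ident) auto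
    then show "(\<lambda>n. clamp_norm (real (Suc n)) (f x)) \<longlonglongrightarrow> f x"
      by (intro tendsto_eventually) (auto simp: eventually_sequentially)
  qed
  show "(cmod (f x - clamp_norm (real (Suc n)) (f x)))\<^sup>2 \<le> (cmod (f x))\<^sup>2" for n x
    by (intro power_mono norm_diff_clamp_norm_le) auto
qed

section \<open>Bessel's inequality and Parseval's identity\<close>

lemma integral_fourier_mode:
  "(\<integral>x. fourier_mode k x \<partial>circle) = (if k = 0 then 2 * pi else 0)"
proof -
  have "(fourier_mode k has_integral (if k = 0 then 2 * pi else 0)) {0..2 * pi}"
  proof (cases "k = 0")
    case True
    then show ?thesis using has_integral_const_real [of "1::complex" 0 "2 * pi"]
      by (simp add: fourier_mode_eq_cis [abs_def] scaleR_conv_of_real)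
  next
    case False
    have "(fourier_mode k has_integral
        fourier_mode k (2 * pi) / (\<i> * of_int k) - fourier_mode k 0 / (\<i> * of_int k)) {0..2 * pi}"
    proof (rule fundamental_theorem_of_calculus)
      fix x
      show "((\<lambda>x. fourier_mode k x / (\<i> * of_int k)) has_vector_derivative fourier_mode k x)
          (at x within {0..2 * pi})"
        unfolding fourier_mode_def using False
        by (auto intro!: has_vector_derivative_real_field derivative_eq_intros
            simp: field_simps power2_eq_square)
    qed simp
    moreover have "fourier_mode k (2 * pi) = 1"
      using cis_multiple_2pi [of "of_int k"] by (simp add: fourier_mode_eq_cis mult_ac)
    moreover have "fourier_mode k 0 = 1" by (simp add: fourier_mode_def)
    ultimately show ?thesis using False by simp
  qed
  then show ?thesis
    by (subst lebesgue_integral_eq_integral)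
       (auto intro!: continuous_imp_integrable_real continuous_intros integral_unique)
qed

text \<open>Completing the square separates the choice of \<open>b\<close> from the defect in
  Bessel's inequality. Fourier coefficients as \<open>b\<close> give Bessel; an approximating
  polynomial gives Parseval.\<close>

lemma L2_expansion:
  assumes f: "f square_integrable_on {0..2 * pi}" and K: "finite K"
  shows "(\<integral>x. (cmod (f x - (\<Sum>k\<in>K. b k * fourier_mode k x)))\<^sup>2 \<partial>circle) =
    (\<integral>x. (cmod (f x))\<^sup>2 \<partial>circle) - 2 * pi * (\<Sum>k\<in>K. (cmod (fourier_coeff f k))\<^sup>2)
      + 2 * pi * (\<Sum>k\<in>K. (cmod (b k - fourier_coeff f k))\<^sup>2)"
proof -
  define q where "q = (\<lambda>x. \<Sum>k\<in>K. b k * fourier_mode k x)"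
  have fm [measurable]: "f \<in> borel_measurable circle" and fi: "integrable circle (\<lambda>x. (cmod (f x))\<^sup>2)"
    using f by (auto simp: square_integrable_on_def)
  have [measurable]: "(\<lambda>x. cnj (fourier_mode k x)) \<in> borel_measurable circle" for k
    by (intro continuous_imp_measurable_on_sets_lebesgue continuous_intros) auto
  have fe: "integrable circle (\<lambda>x. f x * cnj (fourier_mode k x))" for k
  proof (rule Bochner_Integration.integrable_bound)
    show "integrable circle (\<lambda>x. 1 + (cmod (f x))\<^sup>2)"
      by (rule Bochner_Integration.integrable_add [OF continuous_imp_integrable_real fi])
        (intro continuous_intros)
    have "cmod (f x) \<le> 1 + (cmod (f x))\<^sup>2" for x
      using sum_squares_bound [of 1 "cmod (f x)"] by simp (smt (verit) norm_ge_zero)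
    then show "AE x in circle. cmod (f x * cnj (fourier_mode k x)) \<le> norm (1 + (cmod (f x))\<^sup>2)"
      by (simp add: norm_mult fourier_mode_eq_cis)
  qed measurable
  have inner: "(\<integral>x. f x * cnj (q x) \<partial>circle) = 2 * pi * (\<Sum>k\<in>K. cnj (b k) * fourier_coeff f k)"
    "integrable circle (\<lambda>x. f x * cnj (q x))"
  proof -
    have eq: "f x * cnj (q x) = (\<Sum>k\<in>K. cnj (b k) * (f x * cnj (fourier_mode k x)))" for x
      by (simp add: q_def sum_distrib_left mult_ac)
    show "integrable circle (\<lambda>x. f x * cnj (q x))"
      unfolding eq using fe by auto
    show "(\<integral>x. f x * cnj (q x) \<partial>circle) = 2 * pi * (\<Sum>k\<in>K. cnj (b k) * fourier_coeff f k)"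
    proof -
      have "(\<integral>x. f x * cnj (q x) \<partial>circle) = (\<Sum>k\<in>K. cnj (b k) * torus_inner f (fourier_mode k))"
        unfolding eq torus_inner_def using fe by simp
      then show ?thesis by (simp add: fourier_coeff_def sum_distrib_left)
    qed
  qed
  have norm_q: "complex_of_real (\<integral>x. (cmod (q x))\<^sup>2 \<partial>circle) = of_real (2 * pi * (\<Sum>k\<in>K. (cmod (b k))\<^sup>2))"
  proof -
    have eq: "complex_of_real ((cmod (q x))\<^sup>2) =
        (\<Sum>k\<in>K. \<Sum>m\<in>K. b k * cnj (b m) * fourier_mode (k - m) x)" for x
      unfolding complex_norm_square q_def cnj_sum sum_product
      by (intro sum.cong refl) (simp add: fourier_mode_eq_cis cis_cnj left_diff_distrib cis_mult)
    have int: "integrable circle (fourier_mode k)" for k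
      by (intro continuous_imp_integrable_real continuous_intros)
    have "complex_of_real (\<integral>x. (cmod (q x))\<^sup>2 \<partial>circle) = (\<integral>x. complex_of_real ((cmod (q x))\<^sup>2) \<partial>circle)"
      by (rule integral_complex_of_real [symmetric])
    also have "\<dots> = (\<Sum>k\<in>K. \<Sum>m\<in>K. b k * cnj (b m) * (if k = m then 2 * pi else 0))"
      unfolding eq using int by (simp add: integral_fourier_mode)
    also have "\<dots> = (\<Sum>k\<in>K. b k * cnj (b k) * (2 * pi))"
      using K by (intro sum.cong refl) (simp add: if_distrib cong: if_cong)
    also have "\<dots> = of_real (2 * pi * (\<Sum>k\<in>K. (cmod (b k))\<^sup>2))"
      by (simp add: complex_norm_square [symmetric] sum_distrib_left mult.commute flip: of_real_power)
    finally show ?thesis .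
  qed
  have qi: "integrable circle (\<lambda>x. (cmod (q x))\<^sup>2)"
    unfolding q_def by (intro continuous_imp_integrable_real continuous_intros)
  have pt: "(cmod (z - w))\<^sup>2 = (cmod z)\<^sup>2 - 2 * Re (z * cnj w) + (cmod w)\<^sup>2" for z w
    unfolding cmod_power2 by (simp add: power2_eq_square algebra_simps)
  have "(\<integral>x. (cmod (f x - q x))\<^sup>2 \<partial>circle) =
      (\<integral>x. (cmod (f x))\<^sup>2 \<partial>circle) - 2 * Re (\<integral>x. f x * cnj (q x) \<partial>circle) + (\<integral>x. (cmod (q x))\<^sup>2 \<partial>circle)"
  proof -
    define r where "r = (\<lambda>x. Re (f x * cnj (q x)))"
    have "integrable circle r" "(\<integral>x. r x \<partial>circle) = Re (\<integral>x. f x * cnj (q x) \<partial>circle)"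
      unfolding r_def using inner(2) by (rule integrable_Re, rule integral_Re)
    moreover have "(cmod (f x - q x))\<^sup>2 = (cmod (f x))\<^sup>2 - 2 * r x + (cmod (q x))\<^sup>2" for x
      unfolding r_def by (rule pt)
    ultimately show ?thesis using fi qi by simp
  qed
  also have "(\<integral>x. (cmod (q x))\<^sup>2 \<partial>circle) = 2 * pi * (\<Sum>k\<in>K. (cmod (b k))\<^sup>2)"
    using norm_q of_real_eq_iff by blast
  also have "Re (\<integral>x. f x * cnj (q x) \<partial>circle) = 2 * pi * (\<Sum>k\<in>K. Re (fourier_coeff f k * cnj (b k)))"
    unfolding inner(1) by (simp add: Re_sum mult.commute)
  also have "(\<integral>x. (cmod (f x))\<^sup>2 \<partial>circle) - 2 * (2 * pi * (\<Sum>k\<in>K. Re (fourier_coeff f k * cnj (b k)))) +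
      2 * pi * (\<Sum>k\<in>K. (cmod (b k))\<^sup>2) =
      (\<integral>x. (cmod (f x))\<^sup>2 \<partial>circle) - 2 * pi * (\<Sum>k\<in>K. (cmod (fourier_coeff f k))\<^sup>2)
      + 2 * pi * (\<Sum>k\<in>K. (cmod (fourier_coeff f k))\<^sup>2 - 2 * Re (fourier_coeff f k * cnj (b k)) + (cmod (b k))\<^sup>2)"
    by (simp add: sum.distrib sum_subtractf sum_distrib_left algebra_simps)
  finally show ?thesis
    unfolding q_def by (simp only: pt [symmetric] norm_minus_commute)
qed

lemma bessel_inequality:
  assumes "f square_integrable_on {0..2 * pi}" "finite K"
  shows "2 * pi * (\<Sum>k\<in>K. (cmod (fourier_coeff f k))\<^sup>2) \<le> (\<integral>x. (cmod (f x))\<^sup>2 \<partial>circle)"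
proof -
  have "0 \<le> (\<integral>x. (cmod (f x - (\<Sum>k\<in>K. fourier_coeff f k * fourier_mode k x)))\<^sup>2 \<partial>circle)"
    by (intro integral_nonneg_AE) auto
  then show ?thesis using L2_expansion [OF assms, of "fourier_coeff f"] by simp
qed

text \<open>The half of Parseval's identity that rests on completeness: an approximating polynomial
  with error \<open>e\<close> has finite support \<open>K\<close>, and the Bessel defect on
  \<open>K\<close> is then at most \<open>e\<close>. A common bound \<open>B\<close> on finite sums
  takes the place of the infinite sum.\<close>

lemma parseval_le:
  assumes f: "f square_integrable_on {0..2 * pi}"
    and B: "\<And>K. finite K \<Longrightarrow> 2 * pi * (\<Sum>k\<in>K. (cmod (fourier_coeff f k))\<^sup>2) \<le> B"
  shows "(\<integral>x. (cmod (f x))\<^sup>2 \<partial>circle) \<le> B"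
proof (rule field_le_epsilon)
  fix e :: real assume "e > 0"
  then obtain q where "trig_poly q" and q: "(\<integral>x. (cmod (f x - q x))\<^sup>2 \<partial>circle) \<le> e"
    using trig_approximable_L2 [OF f] unfolding trig_approximable_def by blast
  then obtain K b where K: "finite K" "q = (\<lambda>x. \<Sum>k\<in>K. b k * fourier_mode k x)"
    by (auto simp: trig_poly_def)
  have "(\<Sum>k\<in>K. (cmod (b k - fourier_coeff f k))\<^sup>2) \<ge> 0" by (intro sum_nonneg) auto
  then have "2 * pi * (\<Sum>k\<in>K. (cmod (b k - fourier_coeff f k))\<^sup>2) \<ge> 0" by simp
  then show "(\<integral>x. (cmod (f x))\<^sup>2 \<partial>circle) \<le> B + e"
    using q B [OF K(1)] L2_expansion [OF f K(1), of b] unfolding K(2) by linarith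
qed

section \<open>Passage to the limit\<close>

text \<open>If \<open>K0\<close> comes within \<open>e\<close> of the supremum of all finite sums, a
  disjoint set can add no more than \<open>e\<close>.\<close>

lemma bounded_sums_small_tail:
  fixes h :: "'a \<Rightarrow> real"
  assumes h: "\<And>k. h k \<ge> 0" and B: "\<And>K. finite K \<Longrightarrow> sum h K \<le> B" and e: "e > 0"
  shows "\<exists>K0. finite K0 \<and> (\<forall>K. finite K \<longrightarrow> K \<inter> K0 = {} \<longrightarrow> sum h K \<le> e)"
proof -
  define X where "X = sum h ` {K. finite K}"
  have X: "X \<noteq> {}" "bdd_above X" unfolding X_def using B by (auto intro!: bdd_aboveI [of _ B])
  have "Sup X - e < Sup X" using e by simp
  then obtain y where "y \<in> X" "Sup X - e < y"
    using less_cSup_iff [OF X] by blast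
  then obtain K0 where K0: "finite K0" "Sup X - e < sum h K0"
    by (auto simp: X_def)
  have "sum h K \<le> e" if "finite K" "K \<inter> K0 = {}" for K
  proof -
    have "sum h (K \<union> K0) \<le> Sup X" using that K0 X(2) by (intro cSup_upper) (auto simp: X_def)
    then show ?thesis using K0 that by (simp add: sum.union_disjoint)
  qed
  with K0(1) show ?thesis by blast
qed

lemma line_energy_eq_lebesgue:
  "line_energy T l v a K = (\<integral>t. (cmod (\<Sum>k\<in>K. a k * cis (freq l v k * t)))\<^sup>2 \<partial>lebesgue_on {0..T})"
  unfolding line_energy_def
  by (intro lebesgue_integral_eq_integral [symmetric] continuous_imp_integrable_real continuous_intros) auto

text \<open>The base point is absorbed as a phase, so the coefficients on both lines have the moduli
  of the Fourier coefficients.\<close>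

definition line_coeff :: "nat \<Rightarrow> (real \<Rightarrow> complex) \<Rightarrow> real \<Rightarrow> real \<Rightarrow> int \<Rightarrow> complex" where
  "line_coeff l u0 t0 x0 k = fourier_coeff u0 k * cis (dispersion l k * t0 + of_int k * x0)"

lemma norm_line_coeff: "cmod (line_coeff l u0 t0 x0 k) = cmod (fourier_coeff u0 k)"
  by (simp add: line_coeff_def norm_mult)

lemma line_term_eq_cis:
  assumes "u0 \<in> L2_torus" "is_solution l u0 u"
  shows "line_term u t0 x0 v k t = line_coeff l u0 t0 x0 k * cis (freq l v k * t)"
  unfolding line_term_eq [OF assms] line_coeff_def freq_def cis_conv_exp by (simp add: mult.assoc)

text \<open>Existence is what gives the choice in \<open>line_restriction\<close> its meaning.
  Bessel's inequality makes coefficient tails small, and the upper Ingham bound transfers this to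
  the line.\<close>

lemma line_restriction_has_L2_sum:
  assumes "l > 1" "T > 0" and u: "u0 \<in> L2_torus" "is_solution l u0 u"
  shows "has_L2_sum (line_term u t0 x0 v) (line_restriction u t0 x0 v T) {0..T}"
  unfolding line_restriction_def
proof (rule someI_ex [of "\<lambda>g. has_L2_sum (line_term u t0 x0 v) g {0..T}"], rule L2_sum_exists)
  let ?a = "line_coeff l u0 t0 x0"
  have u0: "u0 square_integrable_on {0..2 * pi}" using u(1) by (simp add: L2_torus_def)
  show "emeasure (lebesgue_on {0..T}) (space (lebesgue_on {0..T})) < \<infinity>"
    using assms(2) by (simp add: emeasure_restrict_space)
  show "line_term u t0 x0 v k square_integrable_on {0..T}" for k
    unfolding line_term_eq_cis [OF u, abs_def]
    by (intro continuous_square_integrable continuous_intros)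
  fix e :: real assume e: "e > 0"
  obtain C where C: "C > 0" "\<And>K a. finite K \<Longrightarrow> line_energy T l v a K \<le> C * (\<Sum>k\<in>K. (cmod (a k))\<^sup>2)"
    using line_ingham [OF assms(1,2), of v] by blast
  obtain K0 where K0: "finite K0"
    "\<And>K. finite K \<Longrightarrow> K \<inter> K0 = {} \<Longrightarrow> (\<Sum>k\<in>K. (cmod (fourier_coeff u0 k))\<^sup>2) \<le> e / C"
  proof -
    have "(\<Sum>k\<in>K. (cmod (fourier_coeff u0 k))\<^sup>2) \<le> (\<integral>x. (cmod (u0 x))\<^sup>2 \<partial>circle) / (2 * pi)"
      if "finite K" for K
      using bessel_inequality [OF u0 that] by (simp add: field_simps)
    from bounded_sums_small_tail [OF _ this, of "e / C"] show ?thesis using that e C(1) by auto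
  qed
  show "\<exists>K0. finite K0 \<and> (\<forall>K. finite K \<longrightarrow> K \<inter> K0 = {} \<longrightarrow>
      (\<integral>t. (cmod (\<Sum>k\<in>K. line_term u t0 x0 v k t))\<^sup>2 \<partial>lebesgue_on {0..T}) \<le> e)"
  proof (intro exI [of _ K0] conjI allI impI K0(1))
    fix K assume K: "finite K" "K \<inter> K0 = {}"
    have "(\<integral>t. (cmod (\<Sum>k\<in>K. line_term u t0 x0 v k t))\<^sup>2 \<partial>lebesgue_on {0..T}) = line_energy T l v ?a K"
      by (simp add: line_term_eq_cis [OF u] line_energy_eq_lebesgue)
    also have "\<dots> \<le> C * (\<Sum>k\<in>K. (cmod (fourier_coeff u0 k))\<^sup>2)"
      using C(2) [OF K(1), of ?a] by (simp add: norm_line_coeff)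
    also have "\<dots> \<le> C * (e / C)" using C(1) K0(2) [OF K] by (intro mult_left_mono) auto
    finally show "(\<integral>t. (cmod (\<Sum>k\<in>K. line_term u t0 x0 v k t))\<^sup>2 \<partial>lebesgue_on {0..T}) \<le> e"
      using C(1) by simp
  qed
qed

lemma line_energy_le_restriction:
  fixes t0 x0 v T :: real
  assumes "l > 1" "T > 0" and u: "u0 \<in> L2_torus" "is_solution l u0 u" and "finite K"
  defines "g \<equiv> line_restriction u t0 x0 v T"
  shows "line_energy T l v (line_coeff l u0 t0 x0) K \<le>
    2 * (\<integral>t. (cmod ((\<Sum>k\<in>K. line_term u t0 x0 v k t) - g t))\<^sup>2 \<partial>lebesgue_on {0..T}) +
    2 * (\<integral>t. (cmod (g t))\<^sup>2 \<partial>lebesgue_on {0..T})"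
proof -
  have sum: "has_L2_sum (line_term u t0 x0 v) g {0..T}"
    unfolding g_def by (rule line_restriction_has_L2_sum [OF assms(1-4)])
  have "(\<lambda>t. \<Sum>k\<in>K. line_term u t0 x0 v k t) square_integrable_on {0..T}"
    using sum assms(5) by (intro square_integrable_sum) (auto simp: has_L2_sum_def)
  moreover have "g square_integrable_on {0..T}" using sum by (simp add: has_L2_sum_def)
  moreover have "(\<lambda>t. 0) square_integrable_on {0..T}" by (simp add: square_integrable_on_def)
  ultimately show ?thesis
    using integral_L2_triangle [of "\<lambda>t. \<Sum>k\<in>K. line_term u t0 x0 v k t" "{0..T}" g "\<lambda>t. 0"]
    by (simp add: line_energy_eq_lebesgue line_term_eq_cis [OF u])
qed

theorem theorem5p2:
  fixes l :: nat and t1 x1 t2 x2 v1 v2 T :: real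
  assumes "l > 1" and "v1 \<noteq> v2" and "T > 0"
  shows "\<exists>C>0. \<forall>u0 u. u0 \<in> L2_torus \<longrightarrow> is_solution l u0 u \<longrightarrow>
           (\<integral>x. (cmod (u0 x))\<^sup>2 \<partial>lebesgue_on {0..2 * pi})
             \<le> C * (\<integral>t. (cmod (line_restriction u t1 x1 v1 T t))\<^sup>2
                       + (cmod (line_restriction u t2 x2 v2 T t))\<^sup>2 \<partial>lebesgue_on {0..T})"
proof -
  obtain C where C: "C > 0" "\<And>K a1 a2. finite K \<Longrightarrow> (\<forall>k. cmod (a1 k) = cmod (a2 k)) \<Longrightarrow>
     (\<Sum>k\<in>K. (cmod (a1 k))\<^sup>2) \<le> C * (line_energy T l v1 a1 K + line_energy T l v2 a2 K)"
    using finite_observability [OF assms] by blast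
  show ?thesis
  \<comment> \<open>The factor \<open>2 * pi\<close> comes from Parseval's identity, the remaining 2
    from the triangle inequality between partial sums and restriction.\<close>
  proof (intro exI [of _ "4 * pi * C"] conjI allI impI)
    fix u0 u assume u: "u0 \<in> L2_torus" "is_solution l u0 u"
    define g1 where "g1 = line_restriction u t1 x1 v1 T"
    define g2 where "g2 = line_restriction u t2 x2 v2 T"
    define N where "N = (\<lambda>g. \<integral>t. (cmod (g t))\<^sup>2 \<partial>lebesgue_on {0..T})"
    define r1 where "r1 = (\<lambda>K. N (\<lambda>t. (\<Sum>k\<in>K. line_term u t1 x1 v1 k t) - g1 t))"
    define r2 where "r2 = (\<lambda>K. N (\<lambda>t. (\<Sum>k\<in>K. line_term u t2 x2 v2 k t) - g2 t))"
    have sum: "has_L2_sum (line_term u t1 x1 v1) g1 {0..T}" "has_L2_sum (line_term u t2 x2 v2) g2 {0..T}"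
      unfolding g1_def g2_def by (rule line_restriction_has_L2_sum [OF assms(1,3) u])+
    have lim: "((\<lambda>K. C * (2 * r1 K + 2 * N g1 + (2 * r2 K + 2 * N g2))) \<longlongrightarrow>
        C * (2 * 0 + 2 * N g1 + (2 * 0 + 2 * N g2))) (finite_subsets_at_top UNIV)"
      using sum unfolding r1_def r2_def N_def has_L2_sum_def by (intro tendsto_intros) auto
    \<comment> \<open>\<open>K0\<close> stays fixed while \<open>K\<close> grows beyond it: the left
      side does not change, and the errors \<open>r1\<close> and \<open>r2\<close> vanish in the
      limit.\<close>
    have "(\<Sum>k\<in>K0. (cmod (fourier_coeff u0 k))\<^sup>2) \<le> C * (2 * N g1 + 2 * N g2)" if K0: "finite K0" for K0
    proof -
      have "\<forall>\<^sub>F K in finite_subsets_at_top UNIV. finite K \<and> K0 \<subseteq> K"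
        unfolding eventually_finite_subsets_at_top using K0 by blast
      then have "\<forall>\<^sub>F K in finite_subsets_at_top UNIV.
          (\<Sum>k\<in>K0. (cmod (fourier_coeff u0 k))\<^sup>2) \<le> C * (2 * r1 K + 2 * N g1 + (2 * r2 K + 2 * N g2))"
      proof eventually_elim
        case (elim K)
        let ?a1 = "line_coeff l u0 t1 x1" and ?a2 = "line_coeff l u0 t2 x2"
        have "(\<Sum>k\<in>K0. (cmod (fourier_coeff u0 k))\<^sup>2) \<le> (\<Sum>k\<in>K. (cmod (?a1 k))\<^sup>2)"
          using elim by (simp add: norm_line_coeff sum_mono2)
        also have "\<dots> \<le> C * (line_energy T l v1 ?a1 K + line_energy T l v2 ?a2 K)"
          using elim by (intro C(2)) (auto simp: norm_line_coeff)
        also have "\<dots> \<le> C * (2 * r1 K + 2 * N g1 + (2 * r2 K + 2 * N g2))"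
          unfolding r1_def r2_def N_def g1_def g2_def using C(1) elim
          by (intro mult_left_mono add_mono line_energy_le_restriction [OF assms(1,3) u]) auto
        finally show ?case .
      qed
      from tendsto_lowerbound [OF lim this] show ?thesis by simp
    qed
    then have "2 * pi * (\<Sum>k\<in>K0. (cmod (fourier_coeff u0 k))\<^sup>2) \<le> 2 * pi * (C * (2 * N g1 + 2 * N g2))"
      if "finite K0" for K0
      using that by (intro mult_left_mono) auto
    then have "(\<integral>x. (cmod (u0 x))\<^sup>2 \<partial>circle) \<le> 2 * pi * (C * (2 * N g1 + 2 * N g2))"
      using u(1) by (intro parseval_le) (auto simp: L2_torus_def)
    also have "\<dots> = 4 * pi * C * (N g1 + N g2)" by (simp add: algebra_simps)
    also have "N g1 + N g2 = (\<integral>t. (cmod (g1 t))\<^sup>2 + (cmod (g2 t))\<^sup>2 \<partial>lebesgue_on {0..T})"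
      using sum by (simp add: N_def has_L2_sum_def square_integrable_on_def)
    finally show "(\<integral>x. (cmod (u0 x))\<^sup>2 \<partial>lebesgue_on {0..2 * pi})
        \<le> 4 * pi * C * (\<integral>t. (cmod (line_restriction u t1 x1 v1 T t))\<^sup>2
                       + (cmod (line_restriction u t2 x2 v2 T t))\<^sup>2 \<partial>lebesgue_on {0..T})"
      by (simp add: g1_def g2_def)
  qed (use C in auto)
qed

end
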